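(* Let $(\Sigma,\mathring g)$ be the standard round sphere of radius $1$, and let $(\Sigma,g=\Omega^2\mathring g)$ be a conformal deformation of this metric (with $\Omega>0$), with Gauss curvature $K$. Then the conformal factor $\Omega$ satisfies $$K=\Omega^{-2}\big(1-\Delta_{\mathring g}\log\Omega\big).$$ Define the symmetric $2$-tensor $\Xi$ by $$\Xi=-\mathring g+|\mathrm{d}\log\Omega|_{\mathring g}^2\,\mathring g-2\,\mathrm{d}(\log\Omega)\otimes\mathrm{d}(\log\Omega)+2\nabla_{\mathring g}^2\log\Omega,$$ and decompose $\Xi$ into its trace-free part $\widehat\Xi$ and trace part with respect to $\mathring g$: $$\Xi=\widehat\Xi+\tfrac12\,\mathrm{tr}_{\mathring g}\Xi\;\mathring g .$$ Then $$K=-\frac{1}{2\Omega^2}\,\mathrm{tr}_{\mathring g}\Xi=-\frac12\,\mathrm{tr}_g\Xi,$$ and $$\mathrm{div}_{\mathring g}\widehat\Xi+\Omega^2\,\mathrm{d}K=0.$$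
   Context: $\Delta_{\mathring g}$ is the Laplace–Beltrami operator (trace of the Hessian), $\nabla^2_{\mathring g}$ the Hessian and $\mathrm{div}_{\mathring g}$ the divergence of symmetric $2$-tensors, all taken with respect to the Levi-Civita connection of $\mathring g$; $\mathrm{tr}_{\mathring g}$ and $\mathrm{tr}_g$ denote traces with respect to $\mathring g$ and $g$. *)

theory Defs
  imports "HOL-Analysis.Analysis"
begin

section \<open>Smooth maps\<close>

text \<open>
  Meant for open \<open>S\<close> in a finite-dimensional space, where continuity of all iterated directional
  derivatives is the usual notion of a map of class \<open>C\<^sup>k\<close>.
\<close>

primrec Ck_on ::
  "nat \<Rightarrow> 'a::real_normed_vector set \<Rightarrow> ('a \<Rightarrow> 'b::real_normed_vector) \<Rightarrow> bool" where
  "Ck_on 0 S f \<longleftrightarrow> continuous_on S f"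
| "Ck_on (Suc k) S f \<longleftrightarrow> (\<forall>x\<in>S. f differentiable (at x)) \<and>
     (\<forall>v. Ck_on k S (\<lambda>x. frechet_derivative f (at x) v))"

definition smooth_on ::
  "'a::real_normed_vector set \<Rightarrow> ('a \<Rightarrow> 'b::real_normed_vector) \<Rightarrow> bool" where
  "smooth_on S f \<longleftrightarrow> (\<forall>k. Ck_on k S f)"

section \<open>Calculus on the unit sphere\<close>

text \<open>
  Functions, vector fields and tensor fields on the sphere are total functions on \<open>\<real>\<^sup>3\<close>; only their
  values at points of \<open>S2\<close> (and on vectors tangent there) are meaningful, and everything below
  depends on those values only.  Differentiation goes through the retraction \<open>sgn x = x / |x|\<close>
  of \<open>\<real>\<^sup>3 - {0}\<close> onto the sphere: \<open>f\<close> is smooth on the sphere iff its extension \<open>f \<circ> sgn\<close>, constant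
  along rays, is smooth on \<open>\<real>\<^sup>3 - {0}\<close>, and the differential of \<open>f\<close> on tangent vectors is that of
  the extension.
\<close>

definition S2 :: "(real^3) set" where
  "S2 = sphere 0 1"

definition tangent_space :: "real^3 \<Rightarrow> (real^3) set" where
  "tangent_space p = {v. v \<bullet> p = 0}"

definition smooth_S2 :: "(real^3 \<Rightarrow> 'b::real_normed_vector) \<Rightarrow> bool" where
  "smooth_S2 f \<longleftrightarrow> smooth_on (- {0}) (\<lambda>x. f (sgn x))"

definition differential ::
  "(real^3 \<Rightarrow> 'b::real_normed_vector) \<Rightarrow> real^3 \<Rightarrow> real^3 \<Rightarrow> 'b" where
  "differential f p v = frechet_derivative (\<lambda>x. f (sgn x)) (at p) v"

definition vector_fields :: "(real^3 \<Rightarrow> real^3) set" where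
  "vector_fields = {X. smooth_S2 X \<and> (\<forall>p\<in>S2. X p \<in> tangent_space p)}"

text \<open>
  The bracket \<open>[X, Y]\<close>, in Cartesian coordinates of the ambient space; at points of the sphere it
  is tangent and satisfies \<open>[X, Y] f = X (Y f) - Y (X f)\<close>.
\<close>

definition lie_bracket ::
  "(real^3 \<Rightarrow> real^3) \<Rightarrow> (real^3 \<Rightarrow> real^3) \<Rightarrow> real^3 \<Rightarrow> real^3" where
  "lie_bracket X Y p = differential Y p (X p) - differential X p (Y p)"

text \<open>
  A vector field taking the value \<open>v\<close> at each point where \<open>v\<close> is tangent.  It is used to evaluate
  expressions that are tensorial, so that the choice of the extension is immaterial.
\<close>

definition extend :: "real^3 \<Rightarrow> real^3 \<Rightarrow> real^3" where
  "extend v p = v - (v \<bullet> p) *\<^sub>R p"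

section \<open>Metrics and the Levi-Civita connection\<close>

type_synonym covector_field = "real^3 \<Rightarrow> real^3 \<Rightarrow> real"
type_synonym tensor2_field = "real^3 \<Rightarrow> real^3 \<Rightarrow> real^3 \<Rightarrow> real"
type_synonym connection = "(real^3 \<Rightarrow> real^3) \<Rightarrow> (real^3 \<Rightarrow> real^3) \<Rightarrow> real^3 \<Rightarrow> real^3"

definition round_metric :: tensor2_field where
  "round_metric p u v = u \<bullet> v"

definition conformal_metric :: "(real^3 \<Rightarrow> real) \<Rightarrow> tensor2_field" where
  "conformal_metric \<Omega> p u v = (\<Omega> p)\<^sup>2 * round_metric p u v"

definition affine_connection :: "connection \<Rightarrow> bool" where
  "affine_connection D \<longleftrightarrow>
     (\<forall>X\<in>vector_fields. \<forall>Y\<in>vector_fields. D X Y \<in> vector_fields) \<and>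
     (\<forall>f X X' Y. smooth_S2 f \<longrightarrow> X \<in> vector_fields \<longrightarrow> X' \<in> vector_fields \<longrightarrow> Y \<in> vector_fields \<longrightarrow>
        (\<forall>p\<in>S2. D (\<lambda>q. f q *\<^sub>R X q + X' q) Y p = f p *\<^sub>R D X Y p + D X' Y p)) \<and>
     (\<forall>f X Y Y'. smooth_S2 f \<longrightarrow> X \<in> vector_fields \<longrightarrow> Y \<in> vector_fields \<longrightarrow> Y' \<in> vector_fields \<longrightarrow>
        (\<forall>p\<in>S2. D X (\<lambda>q. f q *\<^sub>R Y q + Y' q) p =
                  differential f p (X p) *\<^sub>R Y p + f p *\<^sub>R D X Y p + D X Y' p))"

definition torsion_free :: "connection \<Rightarrow> bool" where
  "torsion_free D \<longleftrightarrow>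
     (\<forall>X\<in>vector_fields. \<forall>Y\<in>vector_fields. \<forall>p\<in>S2. D X Y p - D Y X p = lie_bracket X Y p)"

definition metric_compatible :: "tensor2_field \<Rightarrow> connection \<Rightarrow> bool" where
  "metric_compatible h D \<longleftrightarrow>
     (\<forall>X\<in>vector_fields. \<forall>Y\<in>vector_fields. \<forall>Z\<in>vector_fields. \<forall>p\<in>S2.
        differential (\<lambda>q. h q (Y q) (Z q)) p (X p) = h p (D X Y p) (Z p) + h p (Y p) (D X Z p))"

text \<open>
  The conditions determine \<open>D X Y\<close> on the sphere for vector fields \<open>X\<close> and \<open>Y\<close> when \<open>h\<close> is a
  Riemannian metric; the choice concerns irrelevant values only.
\<close>

definition levi_civita :: "tensor2_field \<Rightarrow> connection" where
  "levi_civita h = (SOME D. affine_connection D \<and> torsion_free D \<and> metric_compatible h D)"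

section \<open>Traces, derivatives of tensors, curvature\<close>

definition orthonormal_basis_at :: "tensor2_field \<Rightarrow> real^3 \<Rightarrow> real^3 \<Rightarrow> real^3 \<Rightarrow> bool" where
  "orthonormal_basis_at h p e1 e2 \<longleftrightarrow> e1 \<in> tangent_space p \<and> e2 \<in> tangent_space p \<and>
     h p e1 e1 = 1 \<and> h p e2 e2 = 1 \<and> h p e1 e2 = 0"

definition metric_trace :: "tensor2_field \<Rightarrow> tensor2_field \<Rightarrow> real^3 \<Rightarrow> real" where
  "metric_trace h T p =
     (THE t. \<forall>e1 e2. orthonormal_basis_at h p e1 e2 \<longrightarrow> t = T p e1 e1 + T p e2 e2)"

definition trace_free_part :: "tensor2_field \<Rightarrow> tensor2_field \<Rightarrow> tensor2_field" where
  "trace_free_part h T p u v = T p u v - 1/2 * metric_trace h T p * h p u v"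

definition covector_norm2 :: "tensor2_field \<Rightarrow> covector_field \<Rightarrow> real^3 \<Rightarrow> real" where
  "covector_norm2 h \<alpha> = metric_trace h (\<lambda>p u v. \<alpha> p u * \<alpha> p v)"

text \<open>\<open>(\<nabla>\<^sup>2 f) (X, Y) = X (Y f) - (\<nabla>\<^sub>X Y) f\<close>\<close>

definition hessian :: "tensor2_field \<Rightarrow> (real^3 \<Rightarrow> real) \<Rightarrow> tensor2_field" where
  "hessian h f p u v =
     differential (\<lambda>q. differential f q (extend v q)) p u
     - differential f p (levi_civita h (extend u) (extend v) p)"

definition laplacian :: "tensor2_field \<Rightarrow> (real^3 \<Rightarrow> real) \<Rightarrow> real^3 \<Rightarrow> real" where
  "laplacian h f = metric_trace h (hessian h f)"

text \<open>\<open>(\<nabla>\<^sub>X T) (Y, Z) = X (T (Y, Z)) - T (\<nabla>\<^sub>X Y, Z) - T (Y, \<nabla>\<^sub>X Z)\<close>\<close>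

definition covariant_derivative ::
  "tensor2_field \<Rightarrow> tensor2_field \<Rightarrow> real^3 \<Rightarrow> real^3 \<Rightarrow> real^3 \<Rightarrow> real^3 \<Rightarrow> real" where
  "covariant_derivative h T p u v w =
     differential (\<lambda>q. T q (extend v q) (extend w q)) p u
     - T p (levi_civita h (extend u) (extend v) p) w
     - T p v (levi_civita h (extend u) (extend w) p)"

definition divergence :: "tensor2_field \<Rightarrow> tensor2_field \<Rightarrow> covector_field" where
  "divergence h T p w = metric_trace h (\<lambda>q u v. covariant_derivative h T q u v w) p"

definition curvature ::
  "tensor2_field \<Rightarrow> (real^3 \<Rightarrow> real^3) \<Rightarrow> (real^3 \<Rightarrow> real^3) \<Rightarrow> (real^3 \<Rightarrow> real^3) \<Rightarrow> real^3 \<Rightarrow> real^3" where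
  "curvature h X Y Z p =
     (let D = levi_civita h in D X (D Y Z) p - D Y (D X Z) p - D (lie_bracket X Y) Z p)"

text \<open>The sectional curvature of the tangent plane.\<close>

definition gauss_curvature :: "tensor2_field \<Rightarrow> real^3 \<Rightarrow> real" where
  "gauss_curvature h p =
     (THE k. \<forall>u\<in>tangent_space p. \<forall>v\<in>tangent_space p.
        h p (curvature h (extend u) (extend v) (extend v) p) u
          = k * (h p u u * h p v v - (h p u v)\<^sup>2))"

section \<open>The tensor of the conformal factor\<close>

definition Xi :: "(real^3 \<Rightarrow> real) \<Rightarrow> tensor2_field" where
  "Xi \<Omega> p u v = (let \<phi> = (\<lambda>q. ln (\<Omega> q)) in
     - round_metric p u v
     + covector_norm2 round_metric (differential \<phi>) p * round_metric p u v
     - 2 * (differential \<phi> p u * differential \<phi> p v)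
     + 2 * hessian round_metric \<phi> p u v)"

end

theory Submission
  imports Defs
begin

text \<open>
  Put \<open>\<phi> = ln \<Omega>\<close> and extend \<open>\<phi>\<close> to \<open>F x = \<phi> (x / |x|)\<close>, constant along rays.  The whole
  computation is done with the ordinary derivatives \<open>DF\<close>, \<open>D\<^sup>2F\<close>, \<open>D\<^sup>3F\<close> in \<open>\<real>\<^sup>3\<close>.  At a point \<open>p\<close> of
  the sphere the round covariant derivative of a field \<open>extend v\<close> with \<open>v\<close> tangent vanishes, because
  its ambient derivative is normal; hence the differential and the Hessian of \<open>\<phi>\<close> on tangent vectors
  are \<open>DF\<close> and \<open>D\<^sup>2F\<close>, and the Laplacian of \<open>\<phi>\<close> is the ambient Laplacian \<open>L\<close> of \<open>F\<close>.

  The Levi-Civita connection of \<open>\<Omega>\<^sup>2\<close> times the round metric is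
  \<open>\<nabla>\<^sub>X Y + d\<phi>(X) Y + d\<phi>(Y) X - \<langle>X, Y\<rangle> grad \<phi>\<close> with \<open>\<nabla>\<close> the round connection
  (\<open>levi_civita_conformal\<close>).  For tangent \<open>u\<close>, \<open>v\<close> its curvature, paired with \<open>u\<close>, is a combination
  of \<open>|u|\<^sup>2|v|\<^sup>2 - \<langle>u, v\<rangle>\<^sup>2\<close>, \<open>D\<^sup>2F\<close> and \<open>DF \<otimes> DF\<close>; in dimension two the last two enter only through
  their traces times the same Gram determinant (\<open>tangential_trace_gram\<close>), and the gradient
  contributions cancel.  This leaves \<open>K = (1 - L) / \<Omega>\<^sup>2\<close> (\<open>gauss_curvature_conformal\<close>).  The trace of
  \<open>\<Xi>\<close> is \<open>2 L - 2\<close>, since \<open>|d\<phi>|\<^sup>2\<close> times the metric and \<open>2 d\<phi> \<otimes> d\<phi>\<close> have the same trace.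

  The trace-free part of \<open>\<Xi>\<close> is \<open>(|d\<phi>|\<^sup>2 - L) g - 2 d\<phi> \<otimes> d\<phi> + 2 \<nabla>\<^sup>2\<phi>\<close>, where \<open>g\<close> is the round metric.  In
  its divergence the terms containing \<open>\<nabla>\<^sup>2\<phi> (grad \<phi>, \<cdot>)\<close> cancel, and what remains is
  \<open>2 div \<nabla>\<^sup>2\<phi> - dL - 2 L d\<phi>\<close>.  The Bochner identity \<open>div \<nabla>\<^sup>2\<phi> = dL + Ric (grad \<phi>) = dL + d\<phi>\<close> gives
  \<open>dL + 2 (1 - L) d\<phi> = - \<Omega>\<^sup>2 dK\<close>.  In the ambient picture the Ricci term comes from Euler's relations
  for \<open>F\<close>: differentiating \<open>DF(x) x = 0\<close> gives \<open>D\<^sup>2F(x) (x, u) = - DF(x) u\<close> and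
  \<open>D\<^sup>3F(x) (x, x, u) = 2 DF(x) u\<close>, which correct the ambient trace of \<open>D\<^sup>3F\<close> to the tangential one.
\<close>

section \<open>Closure properties of smooth maps\<close>

lemma Ck_on_cong:
  assumes "open S" "\<And>x. x \<in> S \<Longrightarrow> f x = g x" "Ck_on k S f"
  shows "Ck_on k S g"
  using assms(2,3)
proof (induction k arbitrary: f g)
  case 0
  then show ?case using continuous_on_cong by auto
next
  case (Suc k)
  have diff: "f differentiable at x" if "x \<in> S" for x using Suc.prems that by simp
  have "g differentiable at x" if "x \<in> S" for x
    using diff[OF that] Suc.prems(1) unfolding differentiable_def
    by (metis has_derivative_transform_within_open[OF _ assms(1) that, of f _ UNIV g])
  moreover have "Ck_on k S (\<lambda>x. frechet_derivative g (at x) v)" for v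
  proof (rule Suc.IH)
    show "Ck_on k S (\<lambda>x. frechet_derivative f (at x) v)" using Suc.prems by simp
    show "frechet_derivative f (at x) v = frechet_derivative g (at x) v" if "x \<in> S" for x
      using frechet_derivative_transform_within_open[OF diff[OF that] assms(1) that Suc.prems(1)] by simp
  qed
  ultimately show ?case by simp
qed

text \<open>
  Explicit derivatives, known on \<open>S\<close> only, may be used in place of \<open>frechet_derivative\<close>.
\<close>

lemma Ck_on_SucI:
  assumes "open S" "\<And>x. x \<in> S \<Longrightarrow> (f has_derivative f' x) (at x)"
    and "\<And>v. Ck_on k S (\<lambda>x. f' x v)"
  shows "Ck_on (Suc k) S f"
proof -
  have "Ck_on k S (\<lambda>x. frechet_derivative f (at x) v)" for v
    by (rule Ck_on_cong[OF assms(1) _ assms(3)[of v]]) (simp add: frechet_derivative_at[OF assms(2)])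
  then show ?thesis using assms(2) by (auto intro: differentiableI)
qed

lemma Ck_on_Suc_has_derivative:
  assumes "Ck_on (Suc k) S f" "x \<in> S"
  shows "(f has_derivative frechet_derivative f (at x)) (at x)"
  using assms by (simp add: frechet_derivative_works[symmetric])

lemma Ck_on_SucD: "Ck_on (Suc k) S f \<Longrightarrow> Ck_on k S f"
proof (induction k arbitrary: f)
  case 0
  then show ?case
    by (auto intro!: continuous_at_imp_continuous_on differentiable_imp_continuous_within)
qed auto

lemma Ck_on_const: "open S \<Longrightarrow> Ck_on k S (\<lambda>x. c)"
proof (induction k arbitrary: c)
  case (Suc k)
  then show ?case by (intro Ck_on_SucI[where f' = "\<lambda>x h. 0"]) auto
qed auto

lemma Ck_on_bounded_linear:
  assumes "open S" "bounded_linear L"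
  shows "Ck_on k S L"
proof (cases k)
  case 0
  then show ?thesis using assms by (simp add: linear_continuous_on)
next
  case (Suc k)
  have "Ck_on (Suc j) S L" for j
    by (rule Ck_on_SucI[where f' = "\<lambda>x. L"])
      (use assms in \<open>auto intro: Ck_on_const bounded_linear_imp_has_derivative\<close>)
  then show ?thesis using Suc by simp
qed

lemma Ck_on_add:
  assumes "open S" "Ck_on k S f" "Ck_on k S g"
  shows "Ck_on k S (\<lambda>x. f x + g x)"
  using assms(2,3)
proof (induction k arbitrary: f g)
  case 0
  then show ?case by (simp add: continuous_on_add)
next
  case (Suc k)
  show ?case
    by (rule Ck_on_SucI[OF assms(1) has_derivative_add[OF
          Ck_on_Suc_has_derivative[OF Suc.prems(1)] Ck_on_Suc_has_derivative[OF Suc.prems(2)]]])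
      (use Suc in auto)
qed

lemma Ck_on_sum:
  assumes "open S" "\<And>i. i \<in> I \<Longrightarrow> Ck_on k S (f i)"
  shows "Ck_on k S (\<lambda>x. \<Sum>i\<in>I. f i x)"
  using assms(2)
proof (induction I rule: infinite_finite_induct)
  case (insert i I)
  then show ?case using Ck_on_add[OF assms(1), of k "f i" "\<lambda>x. \<Sum>j\<in>I. f j x"] by simp
qed (simp_all add: Ck_on_const assms(1))

text \<open>
  The product rule for an arbitrary bounded bilinear \<open>pr\<close> serves scalar multiples and inner products
  alike.
\<close>

lemma Ck_on_bilinear:
  assumes "open S" "bounded_bilinear pr" "Ck_on k S f" "Ck_on k S g"
  shows "Ck_on k S (\<lambda>x. pr (f x) (g x))"
  using assms(3,4)
proof (induction k arbitrary: f g)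
  case 0
  then show ?case by (simp add: bounded_bilinear.continuous_on[OF assms(2)])
next
  case (Suc k)
  note sub = Suc.prems[THEN Ck_on_SucD]
  show ?case
  proof (rule Ck_on_SucI[OF assms(1) bounded_bilinear.FDERIV[OF assms(2)
          Ck_on_Suc_has_derivative[OF Suc.prems(1)] Ck_on_Suc_has_derivative[OF Suc.prems(2)]]])
    show "Ck_on k S (\<lambda>x. pr (f x) (frechet_derivative g (at x) v)
        + pr (frechet_derivative f (at x) v) (g x))" for v
      using Suc.prems by (intro Ck_on_add[OF assms(1)] Suc.IH sub) auto
  qed
qed

lemma linear_eq_sum_Basis:
  fixes L :: "'a::euclidean_space \<Rightarrow> 'b::real_vector"
  assumes "linear L"
  shows "L v = (\<Sum>b\<in>Basis. (v \<bullet> b) *\<^sub>R L b)"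
  using linear_sum[OF assms] linear_scale[OF assms] by (metis (no_types, lifting) euclidean_representation sum.cong)

text \<open>
  The derivatives in \<open>Ck_on\<close> are taken in constant directions.  The chain rule differentiates the
  outer function in the varying direction \<open>g' x v\<close>, which is therefore expanded in the standard basis.
\<close>

lemma Ck_on_compose:
  fixes f :: "'b::euclidean_space \<Rightarrow> 'c::real_normed_vector"
    and g :: "'a::real_normed_vector \<Rightarrow> 'b"
  assumes "open S" "open T" "g ` S \<subseteq> T" "Ck_on k T f" "Ck_on k S g"
  shows "Ck_on k S (\<lambda>x. f (g x))"
  using assms(4,5)
proof (induction k arbitrary: f)
  case 0
  then show ?case using continuous_on_compose2[OF _ _ assms(3)] by auto
next
  case (Suc k)
  let ?f' = "\<lambda>y. frechet_derivative f (at y)" and ?g' = "\<lambda>x. frechet_derivative g (at x)"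
  have f': "(f has_derivative ?f' (g x)) (at (g x))" if "x \<in> S" for x
    using Ck_on_Suc_has_derivative[OF Suc.prems(1)] that assms(3) by blast
  have d: "((\<lambda>x. f (g x)) has_derivative (\<lambda>h. \<Sum>b\<in>Basis. (?g' x h \<bullet> b) *\<^sub>R ?f' (g x) b)) (at x)"
    if "x \<in> S" for x
    by (rule has_derivative_eq_rhs[OF has_derivative_compose[OF
            Ck_on_Suc_has_derivative[OF Suc.prems(2) that] f'[OF that]]])
      (rule ext, rule linear_eq_sum_Basis[OF has_derivative_linear[OF f'[OF that]]])
  show ?case
  proof (rule Ck_on_SucI[OF assms(1) d])
    fix v
    have "Ck_on k S (\<lambda>x. ?f' (g x) b)" for b
      by (rule Suc.IH) (use Suc.prems Ck_on_SucD in auto)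
    moreover have "Ck_on k S (\<lambda>x. ?g' x v \<bullet> b)" for b
      by (rule Ck_on_bilinear[OF assms(1) bounded_bilinear_inner])
        (use Suc.prems Ck_on_const[OF assms(1)] in auto)
    ultimately show "Ck_on k S (\<lambda>x. \<Sum>b\<in>Basis. (?g' x v \<bullet> b) *\<^sub>R ?f' (g x) b)"
      by (intro Ck_on_sum[OF assms(1)] Ck_on_bilinear[OF assms(1) bounded_bilinear_scaleR])
  qed
qed

text \<open>
  Differentiation lowers the exponent, so the induction has to treat all exponents together.  Powers
  cover the square root and the inverse in \<open>sgn\<close> as well as the derivative of \<open>ln\<close>.
\<close>

lemma Ck_on_powr: "Ck_on k {0::real<..} (\<lambda>t. t powr a)"
proof (induction k arbitrary: a)
  case 0
  then show ?case by (auto intro!: continuous_intros)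
next
  case (Suc k)
  show ?case
  proof (rule Ck_on_SucI)
    show "((\<lambda>t. t powr a) has_derivative (\<lambda>h. (h * a) *\<^sub>R t powr (a - 1))) (at t)"
      if "t \<in> {0<..}" for t
      using has_real_derivative_powr[of t a] that
      by (auto simp: has_field_derivative_def mult_ac elim!: has_derivative_eq_rhs)
    show "Ck_on k {0<..} (\<lambda>t. (v * a) *\<^sub>R t powr (a - 1))" for v :: real
      by (intro Ck_on_bilinear[OF _ bounded_bilinear_scaleR] Ck_on_const Suc) auto
  qed simp
qed

lemma Ck_on_ln: "Ck_on k {0::real<..} ln"
proof (cases k)
  case 0
  then show ?thesis by (auto intro!: continuous_intros)
next
  case (Suc k)
  have "Ck_on (Suc k) {0::real<..} ln"
  proof (rule Ck_on_SucI)
    show "(ln has_derivative (\<lambda>h. h *\<^sub>R t powr (-1))) (at t)" if "t \<in> {0<..}" for t :: real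
      using DERIV_ln[of t] that
      by (auto simp: has_field_derivative_def mult_ac powr_minus elim!: has_derivative_eq_rhs)
    show "Ck_on k {0<..} (\<lambda>t::real. v *\<^sub>R t powr (-1))" for v :: real
      by (intro Ck_on_bilinear[OF _ bounded_bilinear_scaleR] Ck_on_const Ck_on_powr open_greaterThan)
  qed simp
  then show ?thesis using Suc by simp
qed

lemma smooth_on_cong:
  assumes "open S" "\<And>x. x \<in> S \<Longrightarrow> f x = g x" "smooth_on S f"
  shows "smooth_on S g"
  using Ck_on_cong[OF assms(1), of f g] assms(2,3) unfolding smooth_on_def by blast

lemma smooth_on_compose:
  fixes f :: "'b::euclidean_space \<Rightarrow> 'c::real_normed_vector"
  assumes "smooth_on T f" "smooth_on S g" "g ` S \<subseteq> T" "open S" "open T"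
  shows "smooth_on S (\<lambda>x. f (g x))"
  using assms Ck_on_compose unfolding smooth_on_def by blast

context
  fixes S :: "'a::real_normed_vector set"
  assumes S: "open S"
begin

lemma smooth_on_const: "smooth_on S (\<lambda>x. c)"
  using S by (simp add: smooth_on_def Ck_on_const)

lemma smooth_on_bounded_linear: "bounded_linear L \<Longrightarrow> smooth_on S L"
  using S by (simp add: smooth_on_def Ck_on_bounded_linear)

lemma smooth_on_add: "smooth_on S f \<Longrightarrow> smooth_on S g \<Longrightarrow> smooth_on S (\<lambda>x. f x + g x)"
  using S by (simp add: smooth_on_def Ck_on_add)

lemma smooth_on_sum: "(\<And>i. i \<in> I \<Longrightarrow> smooth_on S (f i)) \<Longrightarrow> smooth_on S (\<lambda>x. \<Sum>i\<in>I. f i x)"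
  using S by (simp add: smooth_on_def Ck_on_sum)

lemma smooth_on_bilinear:
  "bounded_bilinear pr \<Longrightarrow> smooth_on S f \<Longrightarrow> smooth_on S g \<Longrightarrow> smooth_on S (\<lambda>x. pr (f x) (g x))"
  using S by (simp add: smooth_on_def Ck_on_bilinear)

lemmas smooth_on_scaleR = smooth_on_bilinear[OF bounded_bilinear_scaleR]
lemmas smooth_on_inner = smooth_on_bilinear[OF bounded_bilinear_inner]

lemma smooth_on_diff:
  assumes "smooth_on S f" "smooth_on S g"
  shows "smooth_on S (\<lambda>x. f x - g x)"
  using smooth_on_add[OF assms(1) smooth_on_scaleR[OF smooth_on_const[of "-1"] assms(2)]] by simp

lemma smooth_on_ident: "smooth_on S (\<lambda>x. x)"
  by (rule smooth_on_bounded_linear) simp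

end

lemma smooth_on_frechet_derivative:
  "smooth_on S f \<Longrightarrow> smooth_on S (\<lambda>x. frechet_derivative f (at x) v)"
  unfolding smooth_on_def by (metis Ck_on.simps(2))

lemma smooth_on_has_derivative:
  "smooth_on S f \<Longrightarrow> x \<in> S \<Longrightarrow> (f has_derivative frechet_derivative f (at x)) (at x)"
  unfolding smooth_on_def using Ck_on_Suc_has_derivative by blast

lemma smooth_on_frechet_derivative_along:
  fixes f :: "'a::euclidean_space \<Rightarrow> 'b::real_normed_vector"
  assumes "open S" "smooth_on S f" "smooth_on S V"
  shows "smooth_on S (\<lambda>x. frechet_derivative f (at x) (V x))"
proof (rule smooth_on_cong[OF assms(1)])
  show "smooth_on S (\<lambda>x. \<Sum>b\<in>Basis. (V x \<bullet> b) *\<^sub>R frechet_derivative f (at x) b)"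
    by (intro smooth_on_sum smooth_on_scaleR smooth_on_inner smooth_on_const
        smooth_on_frechet_derivative assms)
  show "(\<Sum>b\<in>Basis. (V x \<bullet> b) *\<^sub>R frechet_derivative f (at x) b) = frechet_derivative f (at x) (V x)"
    if "x \<in> S" for x
    by (rule linear_eq_sum_Basis[symmetric, OF has_derivative_linear[OF smooth_on_has_derivative[OF assms(2) that]]])
qed

lemma smooth_on_sgn: "smooth_on (- {0::'a::real_inner}) sgn"
proof (rule smooth_on_cong)
  show "smooth_on (- {0::'a}) (\<lambda>x. ((x \<bullet> x) powr (-1/2)) *\<^sub>R x)"
  proof (rule smooth_on_scaleR)
    show "smooth_on (- {0::'a}) (\<lambda>x. (x \<bullet> x) powr (-1/2))"
    proof (rule smooth_on_compose[where g = "\<lambda>x. x \<bullet> x" and f = "\<lambda>t. t powr (-1/2)"])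
      show "smooth_on {0::real<..} (\<lambda>t. t powr (-1/2))"
        unfolding smooth_on_def by (simp add: Ck_on_powr del: powr_minus_divide)
    qed (auto intro!: smooth_on_inner smooth_on_ident)
  qed (auto intro!: smooth_on_ident simp: open_Compl)
  show "((x \<bullet> x) powr (-1/2)) *\<^sub>R x = sgn x" if "x \<in> - {0}" for x :: 'a
    using powr_minus[of "x \<bullet> x" "1/2"] by (simp add: sgn_div_norm norm_eq_sqrt_inner powr_half_sqrt)
qed (simp add: open_Compl)

section \<open>Symmetry of second derivatives\<close>

text \<open>
  Two applications of the mean value theorem express the second difference of \<open>f\<close> over a small
  parallelogram by a mixed second derivative at an intermediate point.
\<close>

lemma second_difference_mean_value:
  fixes f :: "'a::real_normed_vector \<Rightarrow> real"
  assumes h: "0 < h"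
    and dom: "\<And>s t. 0 \<le> s \<Longrightarrow> s \<le> h \<Longrightarrow> 0 \<le> t \<Longrightarrow> t \<le> h \<Longrightarrow> x + s *\<^sub>R u + t *\<^sub>R v \<in> S"
    and f: "\<And>y. y \<in> S \<Longrightarrow> (f has_derivative f' y) (at y)"
    and f'': "\<And>y. y \<in> S \<Longrightarrow> ((\<lambda>y. f' y u) has_derivative f'' y) (at y)"
  obtains s t where "0 < s" "s < h" "0 < t" "t < h"
    "f (x + h *\<^sub>R u + h *\<^sub>R v) - f (x + h *\<^sub>R u) - f (x + h *\<^sub>R v) + f x
      = h * h * f'' (x + s *\<^sub>R u + t *\<^sub>R v) v"
proof -
  let ?g = "\<lambda>s. f (x + s *\<^sub>R u + h *\<^sub>R v) - f (x + s *\<^sub>R u)"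
  have "(?g has_real_derivative f' (x + s *\<^sub>R u + h *\<^sub>R v) u - f' (x + s *\<^sub>R u) u) (at s)"
    if "0 \<le> s" "s \<le> h" for s
  proof -
    have "((\<lambda>s. f (x + s *\<^sub>R u + t *\<^sub>R v)) has_derivative (\<lambda>k. f' (x + s *\<^sub>R u + t *\<^sub>R v) (k *\<^sub>R u))) (at s)"
      if t: "0 \<le> t" "t \<le> h" for t
      by (rule has_derivative_compose[where g = f and f = "\<lambda>s. x + s *\<^sub>R u + t *\<^sub>R v",
            OF _ f[OF dom[OF \<open>0 \<le> s\<close> \<open>s \<le> h\<close> t]]])
        (auto intro!: derivative_eq_intros)
    from this[of h] this[of 0] show ?thesis
      using h linear_scale[OF has_derivative_linear[OF f[OF dom[OF that]]], of h]
        linear_scale[OF has_derivative_linear[OF f[OF dom[OF that]]], of 0]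
      by (auto simp: has_field_derivative_def algebra_simps intro!: derivative_eq_intros)
  qed
  from MVT2[OF h this] obtain s where s: "0 < s" "s < h"
    "?g h - ?g 0 = (h - 0) * (f' (x + s *\<^sub>R u + h *\<^sub>R v) u - f' (x + s *\<^sub>R u) u)" by blast
  have "((\<lambda>t. f' (x + s *\<^sub>R u + t *\<^sub>R v) u) has_real_derivative f'' (x + s *\<^sub>R u + t *\<^sub>R v) v) (at t)"
    if t: "0 \<le> t" "t \<le> h" for t
  proof -
    have mem: "x + s *\<^sub>R u + t *\<^sub>R v \<in> S" using dom s t by auto
    have "((\<lambda>t. f' (x + s *\<^sub>R u + t *\<^sub>R v) u) has_derivative (\<lambda>k. f'' (x + s *\<^sub>R u + t *\<^sub>R v) (k *\<^sub>R v))) (at t)"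
      by (rule has_derivative_compose[where g = "\<lambda>y. f' y u" and f = "\<lambda>t. x + s *\<^sub>R u + t *\<^sub>R v",
            OF _ f''[OF mem]]) (auto intro!: derivative_eq_intros)
    then show ?thesis
      using linear_scale[OF has_derivative_linear[OF f''[OF mem]]]
      by (auto simp: has_field_derivative_def mult_ac elim!: has_derivative_eq_rhs)
  qed
  from MVT2[OF h this] obtain t where t: "0 < t" "t < h"
    "f' (x + s *\<^sub>R u + h *\<^sub>R v) u - f' (x + s *\<^sub>R u + 0 *\<^sub>R v) u
      = (h - 0) * f'' (x + s *\<^sub>R u + t *\<^sub>R v) v" by blast
  show thesis by (rule that[OF s(1,2) t(1,2)]) (use s(3) t(3) in \<open>simp add: algebra_simps\<close>)
qed

text \<open>
  The second difference over a parallelogram is symmetric in its two sides, so both mixed derivatives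
  attain the same value at suitable points of it.  Shrinking the parallelogram and using continuity
  identifies the two derivatives at \<open>x\<close>.
\<close>

lemma frechet_derivative_symmetric:
  fixes f :: "'a::real_normed_vector \<Rightarrow> real"
  assumes "open S" "x \<in> S" "Ck_on 2 S f"
  shows "frechet_derivative (\<lambda>y. frechet_derivative f (at y) u) (at x) v
       = frechet_derivative (\<lambda>y. frechet_derivative f (at y) v) (at x) u"
proof -
  let ?D = "\<lambda>u v y. frechet_derivative (\<lambda>y. frechet_derivative f (at y) u) (at y) v"
  have C: "Ck_on (Suc (Suc 0)) S f" using assms(3) by (simp add: numeral_2_eq_2)
  have f: "(f has_derivative frechet_derivative f (at y)) (at y)" if "y \<in> S" for y
    using Ck_on_Suc_has_derivative[OF C that] .
  have f': "((\<lambda>y. frechet_derivative f (at y) w) has_derivative (\<lambda>z. ?D w z y)) (at y)" if "y \<in> S" for y w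
    using Ck_on_Suc_has_derivative[OF _ that, of 0 "\<lambda>y. frechet_derivative f (at y) w"] C by simp
  have cont: "continuous_on S (?D w z)" for w z using C by simp
  have "\<bar>?D u v x - ?D v u x\<bar> \<le> e" if "e > 0" for e
  proof -
    have "\<exists>r>0. \<forall>y. dist y x < r \<longrightarrow> \<bar>?D w z y - ?D w z x\<bar> < e / 2" for w z
    proof -
      have "continuous (at x) (?D w z)"
        using cont[of w z] assms(2) unfolding continuous_on_eq_continuous_at[OF assms(1)] by blast
      then show ?thesis
        unfolding continuous_at_eps_delta using half_gt_zero[OF \<open>e > 0\<close>] by (metis dist_real_def dist_norm)
    qed
    from this[of u v] this[of v u] obtain r1 r2 where r: "r1 > 0" "r2 > 0"
      "\<And>y. dist y x < r1 \<Longrightarrow> \<bar>?D u v y - ?D u v x\<bar> < e / 2"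
      "\<And>y. dist y x < r2 \<Longrightarrow> \<bar>?D v u y - ?D v u x\<bar> < e / 2" by blast
    obtain r3 where r3: "r3 > 0" "ball x r3 \<subseteq> S" using assms(1,2) openE by blast
    define r where "r = min r1 (min r2 r3)"
    \<comment> \<open>The parallelogram at \<open>x\<close> with sides \<open>h u\<close> and \<open>h v\<close> lies within distance \<open>r\<close> of \<open>x\<close>.\<close>
    define h where "h = r / (2 * (norm u + norm v + 1))"
    have "r > 0" using r r3 by (simp add: r_def)
    then have h: "h > 0" by (simp add: h_def add_nonneg_pos)
    have near: "dist (x + s *\<^sub>R w + t *\<^sub>R z) x < r"
      if "0 \<le> s" "s \<le> h" "0 \<le> t" "t \<le> h" "norm w + norm z = norm u + norm v" for s t w z
    proof -
      have "dist (x + s *\<^sub>R w + t *\<^sub>R z) x \<le> s * norm w + t * norm z"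
        using norm_triangle_ineq[of "s *\<^sub>R w" "t *\<^sub>R z"] that by (simp add: dist_norm)
      also have "\<dots> \<le> h * norm w + h * norm z"
        using that by (intro add_mono mult_right_mono) auto
      also have "\<dots> = h * (norm u + norm v)" using that by (simp flip: distrib_left)
      also have "\<dots> < r" using \<open>r > 0\<close> unfolding h_def
        by (simp add: field_simps add_nonneg_pos add_pos_nonneg)
      finally show ?thesis .
    qed
    have dom: "x + s *\<^sub>R w + t *\<^sub>R z \<in> S"
      if "0 \<le> s" "s \<le> h" "0 \<le> t" "t \<le> h" "norm w + norm z = norm u + norm v" for s t w z
      using near[OF that] r3 unfolding r_def by (auto simp: dist_commute)
    obtain s t where st: "0 < s" "s < h" "0 < t" "t < h"
      "f (x + h *\<^sub>R u + h *\<^sub>R v) - f (x + h *\<^sub>R u) - f (x + h *\<^sub>R v) + f x = h * h * ?D u v (x + s *\<^sub>R u + t *\<^sub>R v)"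
      using second_difference_mean_value[OF h _ f f', of x u v] dom[of _ _ u v] by auto
    obtain s' t' where st': "0 < s'" "s' < h" "0 < t'" "t' < h"
      "f (x + h *\<^sub>R v + h *\<^sub>R u) - f (x + h *\<^sub>R v) - f (x + h *\<^sub>R u) + f x = h * h * ?D v u (x + s' *\<^sub>R v + t' *\<^sub>R u)"
      using second_difference_mean_value[OF h _ f f', of x v u] dom[of _ _ v u] by (auto simp: add.commute)
    have "h * h * ?D u v (x + s *\<^sub>R u + t *\<^sub>R v) = h * h * ?D v u (x + s' *\<^sub>R v + t' *\<^sub>R u)"
      using st(5) st'(5) by (simp add: algebra_simps)
    then have "?D u v (x + s *\<^sub>R u + t *\<^sub>R v) = ?D v u (x + s' *\<^sub>R v + t' *\<^sub>R u)"
      using h by simp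
    moreover have "\<bar>?D u v (x + s *\<^sub>R u + t *\<^sub>R v) - ?D u v x\<bar> < e / 2"
      using near[of s t u v] st by (intro r) (simp add: r_def)
    moreover have "\<bar>?D v u (x + s' *\<^sub>R v + t' *\<^sub>R u) - ?D v u x\<bar> < e / 2"
      using near[of s' t' v u] st' by (intro r) (simp add: r_def add.commute)
    ultimately show ?thesis by linarith
  qed
  then have "\<bar>?D u v x - ?D v u x\<bar> \<le> 0" by (rule field_le_epsilon[of _ 0, simplified])
  then show ?thesis by simp
qed

section \<open>Differentials of functions on the sphere\<close>

lemma S2_simps:
  assumes "p \<in> S2"
  shows "norm p = 1" "p \<noteq> 0" "sgn p = p" "p \<bullet> p = 1"
proof -
  show n: "norm p = 1" using assms by (simp add: S2_def)
  then show "p \<noteq> 0" "sgn p = p" by (auto simp: sgn_div_norm)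
  show "p \<bullet> p = 1" using n by (simp add: norm_eq_1)
qed

lemma sgn_in_S2: "x \<noteq> 0 \<Longrightarrow> sgn x \<in> S2"
  by (simp add: S2_def norm_sgn)

lemma tangent_spaceD: "v \<in> tangent_space p \<Longrightarrow> v \<bullet> p = 0" "v \<in> tangent_space p \<Longrightarrow> p \<bullet> v = 0"
  by (simp_all add: tangent_space_def inner_commute)

lemma open_punctured: "open (- {0::real^3})"
  by (simp add: open_Compl)

lemma has_derivative_sgn_S2:
  assumes "p \<in> S2"
  shows "(sgn has_derivative (\<lambda>h. h - (h \<bullet> p) *\<^sub>R p)) (at p)"
proof -
  have "((\<lambda>x. inverse (norm x) *\<^sub>R x) has_derivative (\<lambda>h. h - (h \<bullet> p) *\<^sub>R p)) (at p)"
    using S2_simps[OF assms] by (auto intro!: derivative_eq_intros has_derivative_norm)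
  then show ?thesis by (simp add: sgn_div_norm[abs_def])
qed

text \<open>
  A function on the sphere may be differentiated through any of its extensions to a neighbourhood,
  because the derivative of \<open>sgn\<close> at a point of the sphere is the orthogonal projection onto the
  tangent space.
\<close>

lemma differential_eq:
  assumes p: "p \<in> S2" and G: "(G has_derivative G') (at p)" and eq: "\<And>q. q \<in> S2 \<Longrightarrow> f q = G q"
  shows "differential f p u = G' (u - (u \<bullet> p) *\<^sub>R p)"
proof -
  have "((\<lambda>x. G (sgn x)) has_derivative (\<lambda>h. G' (h - (h \<bullet> p) *\<^sub>R p))) (at p)"
    by (rule has_derivative_compose[OF has_derivative_sgn_S2[OF p]]) (use G S2_simps[OF p] in simp)
  then have "((\<lambda>x. f (sgn x)) has_derivative (\<lambda>h. G' (h - (h \<bullet> p) *\<^sub>R p))) (at p)"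
    by (rule has_derivative_transform_within_open[OF _ open_punctured])
      (use S2_simps[OF p] eq sgn_in_S2 in auto)
  from frechet_derivative_at[OF this] show ?thesis by (simp add: differential_def fun_eq_iff)
qed

lemma differential_tangent:
  assumes "p \<in> S2" "(G has_derivative G') (at p)" "\<And>q. q \<in> S2 \<Longrightarrow> f q = G q" "u \<in> tangent_space p"
  shows "differential f p u = G' u"
  using differential_eq[OF assms(1-3)] tangent_spaceD[OF assms(4)] by simp

lemma has_derivative_differential:
  assumes "smooth_S2 f" "x \<noteq> 0"
  shows "((\<lambda>x. f (sgn x)) has_derivative differential f x) (at x)"
  using smooth_on_has_derivative[OF assms(1)[unfolded smooth_S2_def], of x] assms(2)
  by (simp add: differential_def[abs_def])

lemma linear_differential: "smooth_S2 f \<Longrightarrow> x \<noteq> 0 \<Longrightarrow> linear (differential f x)"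
  by (rule has_derivative_linear[OF has_derivative_differential])

text \<open>The extension is constant along the ray through \<open>x\<close>.\<close>

lemma differential_radial:
  assumes "smooth_S2 f" "x \<noteq> 0"
  shows "differential f x x = 0"
proof -
  have "((\<lambda>t::real. f (sgn (t *\<^sub>R x))) has_derivative (\<lambda>h. differential f x (h *\<^sub>R x))) (at 1)"
    by (rule has_derivative_compose[where f = "\<lambda>t. t *\<^sub>R x" and g = "\<lambda>x. f (sgn x)"])
      (use has_derivative_differential[OF assms] in \<open>auto intro!: derivative_eq_intros\<close>)
  moreover have "((\<lambda>t::real. f (sgn (t *\<^sub>R x))) has_derivative (\<lambda>h. 0)) (at 1)"
    by (rule has_derivative_transform_within_open[OF has_derivative_const[of "f (sgn x)"], of "{0<..}"])
      (auto simp: sgn_scaleR)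
  ultimately have "(\<lambda>h. differential f x (h *\<^sub>R x)) = (\<lambda>h. 0)"
    by (rule has_derivative_unique)
  then show ?thesis by (metis scaleR_one)
qed

text \<open>
  Smoothness may be checked on any smooth extension to the punctured space, not only on the radially
  constant one.
\<close>

lemma smooth_S2_eqI:
  assumes "smooth_on (- {0}) G" "\<And>q. q \<in> S2 \<Longrightarrow> f q = G q"
  shows "smooth_S2 f"
  unfolding smooth_S2_def
proof (rule smooth_on_cong[OF open_punctured])
  show "smooth_on (- {0}) (\<lambda>x. G (sgn x))"
    by (rule smooth_on_compose[OF assms(1) smooth_on_sgn _ open_punctured open_punctured])
      (auto simp: sgn_zero_iff)
qed (use assms sgn_in_S2 in auto)

lemma smooth_S2_const: "smooth_S2 (\<lambda>q. c)"
  unfolding smooth_S2_def by (rule smooth_on_const[OF open_punctured])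

lemma smooth_S2_ident: "smooth_S2 (\<lambda>q. q)"
  by (rule smooth_S2_eqI[OF smooth_on_ident[OF open_punctured]]) simp

lemma smooth_S2_add: "smooth_S2 f \<Longrightarrow> smooth_S2 g \<Longrightarrow> smooth_S2 (\<lambda>q. f q + g q)"
  unfolding smooth_S2_def by (rule smooth_on_add[OF open_punctured])

lemma smooth_S2_diff: "smooth_S2 f \<Longrightarrow> smooth_S2 g \<Longrightarrow> smooth_S2 (\<lambda>q. f q - g q)"
  unfolding smooth_S2_def by (rule smooth_on_diff[OF open_punctured])

lemma smooth_S2_sum: "(\<And>i. i \<in> I \<Longrightarrow> smooth_S2 (f i)) \<Longrightarrow> smooth_S2 (\<lambda>q. \<Sum>i\<in>I. f i q)"
  unfolding smooth_S2_def by (rule smooth_on_sum[OF open_punctured])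

lemma smooth_S2_scaleR: "smooth_S2 f \<Longrightarrow> smooth_S2 g \<Longrightarrow> smooth_S2 (\<lambda>q. f q *\<^sub>R g q)"
  unfolding smooth_S2_def by (rule smooth_on_scaleR[OF open_punctured])

lemma smooth_S2_inner: "smooth_S2 f \<Longrightarrow> smooth_S2 g \<Longrightarrow> smooth_S2 (\<lambda>q. f q \<bullet> g q)"
  unfolding smooth_S2_def by (rule smooth_on_inner[OF open_punctured])

lemma smooth_S2_differential:
  assumes "smooth_S2 f" "smooth_S2 V"
  shows "smooth_S2 (\<lambda>q. differential f q (V q))"
proof (rule smooth_S2_eqI)
  show "smooth_on (- {0}) (\<lambda>x. frechet_derivative (\<lambda>x. f (sgn x)) (at x) (V (sgn x)))"
    using assms unfolding smooth_S2_def
    by (intro smooth_on_frechet_derivative_along open_punctured)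
qed (simp add: differential_def S2_simps)

lemmas smooth_S2_intros = smooth_S2_const smooth_S2_ident smooth_S2_add smooth_S2_diff
  smooth_S2_sum smooth_S2_scaleR smooth_S2_inner smooth_S2_differential

lemma smooth_S2_ln:
  fixes \<Omega> :: "real^3 \<Rightarrow> real"
  assumes "smooth_S2 \<Omega>" "\<forall>p\<in>S2. \<Omega> p > 0"
  shows "smooth_S2 (\<lambda>q. ln (\<Omega> q))"
  unfolding smooth_S2_def
proof (rule smooth_on_compose[where f = ln and g = "\<lambda>x. \<Omega> (sgn x)"])
  show "smooth_on {0::real<..} ln" by (simp add: smooth_on_def Ck_on_ln)
  show "(\<lambda>x. \<Omega> (sgn x)) ` (- {0}) \<subseteq> {0<..}" using assms(2) sgn_in_S2 by auto
qed (use assms(1) open_punctured in \<open>simp_all add: smooth_S2_def\<close>)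

definition gradient :: "(real^3 \<Rightarrow> real) \<Rightarrow> real^3 \<Rightarrow> real^3" where
  "gradient f p = (\<Sum>b\<in>Basis. differential f p b *\<^sub>R b)"

lemma inner_gradient:
  assumes "smooth_S2 f" "x \<noteq> 0"
  shows "gradient f x \<bullet> v = differential f x v" "v \<bullet> gradient f x = differential f x v"
proof -
  have "differential f x v = (\<Sum>b\<in>Basis. (v \<bullet> b) *\<^sub>R differential f x b)"
    by (rule linear_eq_sum_Basis[OF linear_differential[OF assms]])
  then show "gradient f x \<bullet> v = differential f x v"
    by (simp add: gradient_def inner_sum_left mult.commute inner_commute[of v])
  then show "v \<bullet> gradient f x = differential f x v" by (simp add: inner_commute)
qed

lemma smooth_S2_gradient: "smooth_S2 f \<Longrightarrow> smooth_S2 (gradient f)"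
  unfolding gradient_def[abs_def] by (intro smooth_S2_intros)

section \<open>Vector fields\<close>

lemma vector_fieldsD:
  assumes "X \<in> vector_fields"
  shows "smooth_S2 X" "p \<in> S2 \<Longrightarrow> X p \<in> tangent_space p"
    "p \<in> S2 \<Longrightarrow> X p \<bullet> p = 0" "p \<in> S2 \<Longrightarrow> p \<bullet> X p = 0"
  using assms by (auto simp: vector_fields_def tangent_space_def inner_commute)

text \<open>This is the derivative of the tangency condition \<open>Y q \<bullet> q = 0\<close> in the direction \<open>u\<close>.\<close>

lemma differential_vector_field_normal:
  assumes "Y \<in> vector_fields" "p \<in> S2" "u \<in> tangent_space p"
  shows "differential Y p u \<bullet> p = - (Y p \<bullet> u)"
proof -
  have "((\<lambda>x. Y (sgn x) \<bullet> sgn x) has_derivative (\<lambda>h. Y p \<bullet> (h - (h \<bullet> p) *\<^sub>R p) + differential Y p h \<bullet> p)) (at p)"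
    using has_derivative_inner[OF has_derivative_differential[OF vector_fieldsD(1)[OF assms(1)]]
        has_derivative_sgn_S2[OF assms(2)]] S2_simps[OF assms(2)] by simp
  moreover have "((\<lambda>x. Y (sgn x) \<bullet> sgn x) has_derivative (\<lambda>h. 0)) (at p)"
    by (rule has_derivative_transform_within_open[OF has_derivative_const open_punctured])
      (use S2_simps[OF assms(2)] vector_fieldsD(3)[OF assms(1)] sgn_in_S2 in auto)
  ultimately have "(\<lambda>h. Y p \<bullet> (h - (h \<bullet> p) *\<^sub>R p) + differential Y p h \<bullet> p) = (\<lambda>h. 0)"
    by (rule has_derivative_unique)
  from fun_cong[OF this, of u] show ?thesis using tangent_spaceD[OF assms(3)] by simp
qed

lemma extend_tangent: "v \<in> tangent_space p \<Longrightarrow> extend v p = v"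
  by (simp add: extend_def tangent_space_def)

lemma extend_vector_field: "extend v \<in> vector_fields"
  unfolding vector_fields_def extend_def[abs_def]
  by (auto simp: tangent_space_def inner_diff_left S2_simps intro!: smooth_S2_intros)

lemma has_derivative_extend:
  "(extend v has_derivative (\<lambda>h. - ((v \<bullet> h) *\<^sub>R x + (v \<bullet> x) *\<^sub>R h))) (at x)"
  unfolding extend_def[abs_def] by (auto intro!: derivative_eq_intros)

lemma gradient_tangent:
  "smooth_S2 f \<Longrightarrow> p \<in> S2 \<Longrightarrow> gradient f p \<in> tangent_space p"
  using S2_simps[of p] by (simp add: tangent_space_def inner_gradient differential_radial)

text \<open>
  By \<open>differential_vector_field_normal\<close> the two terms of the bracket have the same normal component.
\<close>

lemma lie_bracket_vector_field:
  assumes "X \<in> vector_fields" "Y \<in> vector_fields"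
  shows "lie_bracket X Y \<in> vector_fields"
  unfolding vector_fields_def lie_bracket_def[abs_def]
  by (auto simp: tangent_space_def[of "_ :: real^3"] inner_diff_left assms
      differential_vector_field_normal[OF assms(1) _ vector_fieldsD(2)[OF assms(2)]]
      differential_vector_field_normal[OF assms(2) _ vector_fieldsD(2)[OF assms(1)]]
      vector_fieldsD(1) inner_commute[of "X _"] intro!: smooth_S2_intros)

section \<open>The Levi-Civita connection of a conformal metric\<close>

text \<open>
  The first two summands are the tangential part of the ambient derivative of \<open>Y\<close>, which is the
  Levi-Civita connection of the round metric; the others account for the conformal factor \<open>exp (2 \<phi>)\<close>.
\<close>

definition conformal_connection :: "(real^3 \<Rightarrow> real) \<Rightarrow> connection" where
  "conformal_connection \<phi> X Y p =
     differential Y p (X p) + (X p \<bullet> Y p) *\<^sub>R p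
     + differential \<phi> p (X p) *\<^sub>R Y p + differential \<phi> p (Y p) *\<^sub>R X p - (X p \<bullet> Y p) *\<^sub>R gradient \<phi> p"

context
  fixes \<phi> :: "real^3 \<Rightarrow> real"
  assumes \<phi>: "smooth_S2 \<phi>"
begin

lemma conformal_connection_vector_field:
  assumes "X \<in> vector_fields" "Y \<in> vector_fields"
  shows "conformal_connection \<phi> X Y \<in> vector_fields"
  unfolding vector_fields_def
proof (intro CollectI conjI ballI)
  show "smooth_S2 (conformal_connection \<phi> X Y)"
    unfolding conformal_connection_def[abs_def]
    by (intro smooth_S2_intros smooth_S2_gradient \<phi> vector_fieldsD assms)
  show "conformal_connection \<phi> X Y p \<in> tangent_space p" if p: "p \<in> S2" for p
    using tangent_spaceD[OF gradient_tangent[OF \<phi> p]] S2_simps[OF p]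
    by (simp add: tangent_space_def conformal_connection_def inner_add_left inner_diff_left
        differential_vector_field_normal[OF assms(2) p vector_fieldsD(2)[OF assms(1) p]]
        vector_fieldsD(3)[OF assms(1) p] vector_fieldsD(3)[OF assms(2) p] inner_commute[of "X p" "Y p"])
qed

lemma affine_connection_conformal: "affine_connection (conformal_connection \<phi>)"
  unfolding affine_connection_def
proof (intro conjI ballI allI impI)
  fix f :: "real^3 \<Rightarrow> real" and X X' Y p
  assume "smooth_S2 f" "X \<in> vector_fields" "X' \<in> vector_fields" "Y \<in> vector_fields" and p: "p \<in> S2"
  then have lin: "linear (differential Y p)" "linear (differential \<phi> p)"
    using S2_simps[OF p] \<phi> vector_fieldsD(1) by (auto intro: linear_differential)
  show "conformal_connection \<phi> (\<lambda>q. f q *\<^sub>R X q + X' q) Y p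
      = f p *\<^sub>R conformal_connection \<phi> X Y p + conformal_connection \<phi> X' Y p"
    by (simp add: conformal_connection_def linear_add[OF lin(1)] linear_add[OF lin(2)]
        linear_scale[OF lin(1)] linear_scale[OF lin(2)] inner_add_left algebra_simps)
next
  fix f :: "real^3 \<Rightarrow> real" and X Y Y' p
  assume f: "smooth_S2 f" and X: "X \<in> vector_fields" and Y: "Y \<in> vector_fields"
    and Y': "Y' \<in> vector_fields" and p: "p \<in> S2"
  note [derivative_intros] = has_derivative_differential[OF f S2_simps(2)[OF p]]
     has_derivative_differential[OF vector_fieldsD(1)[OF Y] S2_simps(2)[OF p]]
     has_derivative_differential[OF vector_fieldsD(1)[OF Y'] S2_simps(2)[OF p]]
  have "((\<lambda>x. f (sgn x) *\<^sub>R Y (sgn x) + Y' (sgn x)) has_derivative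
      (\<lambda>h. f p *\<^sub>R differential Y p h + differential f p h *\<^sub>R Y p + differential Y' p h)) (at p)"
    by (auto intro!: derivative_eq_intros simp: S2_simps[OF p])
  then have *: "differential (\<lambda>q. f q *\<^sub>R Y q + Y' q) p u
      = f p *\<^sub>R differential Y p u + differential f p u *\<^sub>R Y p + differential Y' p u" for u
    by (subst differential_def) (simp add: frechet_derivative_at[symmetric])
  have lin: "linear (differential \<phi> p)"
    using S2_simps[OF p] \<phi> by (auto intro: linear_differential)
  show "conformal_connection \<phi> X (\<lambda>q. f q *\<^sub>R Y q + Y' q) p
      = differential f p (X p) *\<^sub>R Y p + f p *\<^sub>R conformal_connection \<phi> X Y p + conformal_connection \<phi> X Y' p"
    unfolding conformal_connection_def *
    by (simp add: linear_add[OF lin] linear_scale[OF lin] inner_add_right algebra_simps)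
qed (rule conformal_connection_vector_field)

lemma torsion_free_conformal: "torsion_free (conformal_connection \<phi>)"
  by (simp add: torsion_free_def conformal_connection_def lie_bracket_def inner_commute)

lemma metric_compatible_conformal:
  assumes \<Omega>: "\<And>q. q \<in> S2 \<Longrightarrow> \<Omega> q = exp (\<phi> q)"
  shows "metric_compatible (conformal_metric \<Omega>) (conformal_connection \<phi>)"
  unfolding metric_compatible_def
proof (intro ballI)
  fix X Y Z p
  assume X: "X \<in> vector_fields" and Y: "Y \<in> vector_fields" and Z: "Z \<in> vector_fields" and p: "p \<in> S2"
  note [derivative_intros] = has_derivative_differential[OF \<phi> S2_simps(2)[OF p]]
     has_derivative_differential[OF vector_fieldsD(1)[OF Y] S2_simps(2)[OF p]]
     has_derivative_differential[OF vector_fieldsD(1)[OF Z] S2_simps(2)[OF p]]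
  have d: "((\<lambda>x. (exp (\<phi> (sgn x)))\<^sup>2 * (Y (sgn x) \<bullet> Z (sgn x))) has_derivative
      (\<lambda>h. (exp (\<phi> p))\<^sup>2 * (2 * differential \<phi> p h * (Y p \<bullet> Z p)
             + differential Y p h \<bullet> Z p + Y p \<bullet> differential Z p h))) (at p)"
    by (auto intro!: derivative_eq_intros simp: S2_simps[OF p] power2_eq_square algebra_simps)
  have "differential (\<lambda>q. conformal_metric \<Omega> q (Y q) (Z q)) p (X p)
      = (exp (\<phi> p))\<^sup>2 * (2 * differential \<phi> p (X p) * (Y p \<bullet> Z p)
             + differential Y p (X p) \<bullet> Z p + Y p \<bullet> differential Z p (X p))"
    by (rule differential_tangent[OF p d])
      (use vector_fieldsD(2)[OF X p] in \<open>auto simp: conformal_metric_def round_metric_def \<Omega> S2_simps\<close>)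
  also have "\<dots> = conformal_metric \<Omega> p (conformal_connection \<phi> X Y p) (Z p)
      + conformal_metric \<Omega> p (Y p) (conformal_connection \<phi> X Z p)"
    using vector_fieldsD(3,4)[OF Y p] vector_fieldsD(3,4)[OF Z p]
    by (simp add: conformal_metric_def round_metric_def \<Omega>[OF p] conformal_connection_def
        inner_add_left inner_add_right inner_diff_left inner_diff_right
        inner_gradient[OF \<phi> S2_simps(2)[OF p]] inner_commute[of "Y p" "X p"] algebra_simps)
  finally show "differential (\<lambda>q. conformal_metric \<Omega> q (Y q) (Z q)) p (X p) = \<dots>" .
qed

end

text \<open>
  The difference of two torsion-free metric connections is symmetric in its arguments and
  skew-adjoint in the second one, and these two symmetries force it to vanish.
\<close>

lemma metric_connection_unique:
  assumes D: "affine_connection D" "torsion_free D" "metric_compatible (conformal_metric \<Omega>) D"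
    and E: "affine_connection E" "torsion_free E" "metric_compatible (conformal_metric \<Omega>) E"
    and pos: "\<Omega> p > 0" and XY: "X \<in> vector_fields" "Y \<in> vector_fields" and p: "p \<in> S2"
  shows "D X Y p = E X Y p"
proof -
  define S where "S X Y = D X Y p - E X Y p" for X Y
  have sym: "S X Y = S Y X" if "X \<in> vector_fields" "Y \<in> vector_fields" for X Y
  proof -
    have "D X Y p - D Y X p = E X Y p - E Y X p"
      using D(2)[unfolded torsion_free_def, rule_format, OF that p]
        E(2)[unfolded torsion_free_def, rule_format, OF that p] by simp
    then show ?thesis by (simp add: S_def algebra_simps)
  qed
  have skew: "S X Y \<bullet> Z p = - (Y p \<bullet> S X Z)"
    if "X \<in> vector_fields" "Y \<in> vector_fields" "Z \<in> vector_fields" for X Y Z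
  proof -
    have "(\<Omega> p)\<^sup>2 * (D X Y p \<bullet> Z p) + (\<Omega> p)\<^sup>2 * (Y p \<bullet> D X Z p)
        = (\<Omega> p)\<^sup>2 * (E X Y p \<bullet> Z p) + (\<Omega> p)\<^sup>2 * (Y p \<bullet> E X Z p)"
      using D(3)[unfolded metric_compatible_def, rule_format, OF that p]
        E(3)[unfolded metric_compatible_def, rule_format, OF that p]
      by (simp add: conformal_metric_def round_metric_def)
    then have "(\<Omega> p)\<^sup>2 * (D X Y p \<bullet> Z p + Y p \<bullet> D X Z p) = (\<Omega> p)\<^sup>2 * (E X Y p \<bullet> Z p + Y p \<bullet> E X Z p)"
      by (simp add: distrib_left)
    then show ?thesis using pos by (simp add: S_def inner_diff_left inner_diff_right)
  qed
  have zero: "S X Y \<bullet> Z p = 0" if "Z \<in> vector_fields" for Z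
  proof -
    have "S X Y \<bullet> Z p = - (S X Z \<bullet> Y p)" using skew[OF XY that] by (simp add: inner_commute)
    also have "S X Z \<bullet> Y p = - (S Z Y \<bullet> X p)"
      using skew[OF that XY] sym[OF XY(1) that] by (simp add: inner_commute)
    also have "S Z Y \<bullet> X p = - (S X Y \<bullet> Z p)"
      using skew[OF XY(2) that XY(1)] sym[OF XY(2) that] sym[OF XY] by (simp add: inner_commute)
    finally show ?thesis by simp
  qed
  have "S X Y \<bullet> p = 0"
    using D(1) E(1) XY vector_fieldsD(3)[OF _ p] unfolding affine_connection_def S_def
    by (simp add: inner_diff_left)
  then have "S X Y \<bullet> S X Y = 0"
    using zero[OF extend_vector_field[of "S X Y"]] by (simp add: extend_def inner_diff_right)
  then show ?thesis by (simp add: S_def)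
qed

text \<open>
  The explicit connection shows that the choice in \<open>levi_civita\<close> is made from a nonempty set, and
  uniqueness identifies the chosen connection with the explicit one on vector fields.
\<close>

lemma levi_civita_conformal:
  assumes \<phi>: "smooth_S2 \<phi>" and \<Omega>: "\<And>q. q \<in> S2 \<Longrightarrow> \<Omega> q = exp (\<phi> q)"
    and XY: "X \<in> vector_fields" "Y \<in> vector_fields"
  shows "levi_civita (conformal_metric \<Omega>) X Y \<in> vector_fields"
    and "p \<in> S2 \<Longrightarrow> levi_civita (conformal_metric \<Omega>) X Y p = conformal_connection \<phi> X Y p"
proof -
  let ?P = "\<lambda>D. affine_connection D \<and> torsion_free D \<and> metric_compatible (conformal_metric \<Omega>) D"
  let ?D = "levi_civita (conformal_metric \<Omega>)"
  have C: "?P (conformal_connection \<phi>)"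
    using affine_connection_conformal torsion_free_conformal metric_compatible_conformal \<phi> \<Omega> by blast
  then have D: "?P ?D" unfolding levi_civita_def by (rule someI[where P = ?P])
  show "?D X Y \<in> vector_fields"
    by (rule D[THEN conjunct1, unfolded affine_connection_def, THEN conjunct1, rule_format, OF XY])
  show "?D X Y p = conformal_connection \<phi> X Y p" if "p \<in> S2"
    by (rule metric_connection_unique[OF D[THEN conjunct1] D[THEN conjunct2, THEN conjunct1]
          D[THEN conjunct2, THEN conjunct2] C[THEN conjunct1] C[THEN conjunct2, THEN conjunct1]
          C[THEN conjunct2, THEN conjunct2] _ XY that]) (simp add: \<Omega>[OF that])
qed

lemma round_metric_conformal: "round_metric = conformal_metric (\<lambda>q. 1)"
  by (simp add: fun_eq_iff conformal_metric_def)

lemma differential_const: "differential (\<lambda>q. c) p = (\<lambda>v. 0)"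
  by (simp add: differential_def fun_eq_iff)

text \<open>
  The field \<open>extend v\<close> is the orthogonal projection of a constant field, and its ambient derivative at
  a point where \<open>v\<close> is tangent is normal.  Covariant derivatives of tensors evaluated on such fields
  thus have no connection terms at that point.
\<close>

lemma levi_civita_round_extend:
  assumes "p \<in> S2" "u \<in> tangent_space p" "v \<in> tangent_space p"
  shows "levi_civita round_metric (extend u) (extend v) p = 0"
proof -
  have "levi_civita round_metric (extend u) (extend v) p
      = differential (extend v) p u + (u \<bullet> v) *\<^sub>R p"
    using levi_civita_conformal(2)[OF smooth_S2_const[of 0] _ extend_vector_field extend_vector_field assms(1), of "\<lambda>q. 1"]
    by (simp add: round_metric_conformal conformal_connection_def extend_tangent assms differential_const gradient_def)
  also have "differential (extend v) p u = - ((v \<bullet> u) *\<^sub>R p)"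
    using differential_tangent[OF assms(1) has_derivative_extend refl assms(2)] tangent_spaceD[OF assms(3)]
    by simp
  finally show ?thesis by (simp add: inner_commute)
qed

section \<open>Traces over a tangent plane\<close>

text \<open>
  The trace over the tangent plane as the full trace minus the normal entry.  No frame of the tangent
  plane is chosen, which makes the trace of a differentiable family visibly differentiable in \<open>p\<close>.
\<close>

definition tangential_trace :: "real^3 \<Rightarrow> (real^3 \<Rightarrow> real^3 \<Rightarrow> real) \<Rightarrow> real" where
  "tangential_trace p B = (\<Sum>b\<in>Basis. B b b) - B p p"

lemma orthonormal_basis_exists:
  assumes "p \<in> S2"
  obtains e1 e2 where "orthonormal_basis_at round_metric p e1 e2"
proof -
  obtain S where S: "p \<in> S" "pairwise orthogonal S" "\<And>x. x \<in> S \<Longrightarrow> norm x = 1" "card S = DIM(real^3)"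
    using vector_in_orthonormal_basis[OF S2_simps(1)[OF assms]] by metis
  then have "card (S - {p}) = 2" by simp
  then obtain e1 e2 where e: "S - {p} = {e1, e2}" "e1 \<noteq> e2" by (auto simp: card_2_iff)
  then have "e1 \<in> S" "e2 \<in> S" "e1 \<noteq> p" "e2 \<noteq> p" by auto
  then have "orthonormal_basis_at round_metric p e1 e2"
    using S(1-3) e(2) unfolding orthonormal_basis_at_def round_metric_def tangent_space_def pairwise_def orthogonal_def
    by (auto simp: norm_eq_1)
  then show thesis by (rule that)
qed

text \<open>
  A nonzero remainder would be orthogonal to the frame and would give four independent vectors in
  three dimensions.
\<close>

lemma orthonormal_frame_expansion:
  assumes p: "p \<in> S2" and e: "orthonormal_basis_at round_metric p e1 e2"
  shows "v = (v \<bullet> p) *\<^sub>R p + (v \<bullet> e1) *\<^sub>R e1 + (v \<bullet> e2) *\<^sub>R e2"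
proof (rule ccontr)
  define r where "r = v - ((v \<bullet> p) *\<^sub>R p + (v \<bullet> e1) *\<^sub>R e1 + (v \<bullet> e2) *\<^sub>R e2)"
  assume "v \<noteq> (v \<bullet> p) *\<^sub>R p + (v \<bullet> e1) *\<^sub>R e1 + (v \<bullet> e2) *\<^sub>R e2"
  then have r0: "r \<noteq> 0" by (simp add: r_def)
  have o: "p \<bullet> p = 1" "e1 \<bullet> e1 = 1" "e2 \<bullet> e2 = 1" "e1 \<bullet> p = 0" "e2 \<bullet> p = 0" "e1 \<bullet> e2 = 0"
    "p \<bullet> e1 = 0" "p \<bullet> e2 = 0" "e2 \<bullet> e1 = 0"
    using e S2_simps[OF p]
    by (auto simp: orthonormal_basis_at_def round_metric_def tangent_space_def inner_commute)
  have r: "r \<bullet> p = 0" "r \<bullet> e1 = 0" "r \<bullet> e2 = 0"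
    by (simp_all add: r_def inner_diff_left inner_add_left o)
  have "card {r, p, e1, e2} = 4" using o r r0 by (auto simp: card_insert_if)
  moreover have "independent {r, p, e1, e2}"
  proof (rule pairwise_orthogonal_independent)
    show "pairwise orthogonal {r, p, e1, e2}"
      using o r by (auto simp: pairwise_def orthogonal_def inner_commute)
    show "0 \<notin> {r, p, e1, e2}" using o r0 by auto
  qed
  ultimately show False using independent_card_le[of "{r, p, e1, e2}"] by simp
qed

lemma tangential_trace_orthonormal:
  assumes p: "p \<in> S2" and e: "orthonormal_basis_at round_metric p e1 e2" and B: "bilinear B"
  shows "tangential_trace p B = B e1 e1 + B e2 e2"
proof -
  have o: "p \<bullet> p = 1" "e1 \<bullet> e1 = 1" "e2 \<bullet> e2 = 1" "e1 \<bullet> p = 0" "e2 \<bullet> p = 0" "e1 \<bullet> e2 = 0"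
    "p \<bullet> e1 = 0" "p \<bullet> e2 = 0" "e2 \<bullet> e1 = 0"
    using e S2_simps[OF p]
    by (auto simp: orthonormal_basis_at_def round_metric_def tangent_space_def inner_commute)
  note bil = bilinear_ladd[OF B] bilinear_radd[OF B] bilinear_lmul[OF B] bilinear_rmul[OF B]
  have exp: "B b b = (b \<bullet> p) * (b \<bullet> p) * B p p + (b \<bullet> p) * (b \<bullet> e1) * B p e1 + (b \<bullet> p) * (b \<bullet> e2) * B p e2
     + (b \<bullet> e1) * (b \<bullet> p) * B e1 p + (b \<bullet> e1) * (b \<bullet> e1) * B e1 e1 + (b \<bullet> e1) * (b \<bullet> e2) * B e1 e2
     + (b \<bullet> e2) * (b \<bullet> p) * B e2 p + (b \<bullet> e2) * (b \<bullet> e1) * B e2 e1 + (b \<bullet> e2) * (b \<bullet> e2) * B e2 e2" for b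
    by (subst (1 2) orthonormal_frame_expansion[OF p e, of b], unfold bil) (simp add: algebra_simps)
  \<comment> \<open>Summed over the standard basis, the coefficients above become the Gram matrix of the frame.\<close>
  have s: "(\<Sum>b\<in>Basis. (b \<bullet> x) * (b \<bullet> y) * c) = (x \<bullet> y) * c" for x y :: "real^3" and c
    by (simp add: sum_distrib_right[symmetric] euclidean_inner[of x y] inner_commute)
  have "(\<Sum>b\<in>Basis. B b b) = B p p + B e1 e1 + B e2 e2"
    by (rule trans[OF sum.cong[OF refl exp]]) (simp add: sum.distrib s o)
  then show ?thesis by (simp add: tangential_trace_def)
qed

text \<open>
  For orthonormal \<open>u\<close>, \<open>v\<close> this is the definition of the trace, and under a change of \<open>u\<close>, \<open>v\<close> within
  the plane both sides scale by the square of the determinant.  It turns the sectional expressions in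
  the curvature into the Laplacian and the square of the gradient.
\<close>

lemma tangential_trace_gram:
  assumes p: "p \<in> S2" and B: "bilinear B" and u: "u \<in> tangent_space p" and v: "v \<in> tangent_space p"
  shows "(u \<bullet> u) * B v v + (v \<bullet> v) * B u u - (u \<bullet> v) * (B u v + B v u)
    = ((u \<bullet> u) * (v \<bullet> v) - (u \<bullet> v)\<^sup>2) * tangential_trace p B"
proof -
  obtain e1 e2 where e: "orthonormal_basis_at round_metric p e1 e2"
    using orthonormal_basis_exists[OF p] .
  then have o: "e1 \<bullet> e1 = 1" "e2 \<bullet> e2 = 1" "e1 \<bullet> e2 = 0" "e2 \<bullet> e1 = 0"
    by (auto simp: orthonormal_basis_at_def round_metric_def inner_commute)
  note bil = bilinear_ladd[OF B] bilinear_radd[OF B] bilinear_lmul[OF B] bilinear_rmul[OF B]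
  obtain a b where ab: "u = a *\<^sub>R e1 + b *\<^sub>R e2"
    using orthonormal_frame_expansion[OF p e, of u] tangent_spaceD[OF u] by simp
  obtain c d where cd: "v = c *\<^sub>R e1 + d *\<^sub>R e2"
    using orthonormal_frame_expansion[OF p e, of v] tangent_spaceD[OF v] by simp
  show ?thesis
    unfolding ab cd bil inner_add_left inner_add_right inner_scaleR_left inner_scaleR_right o
      tangential_trace_orthonormal[OF p e B]
    by (simp add: power2_eq_square algebra_simps)
qed

text \<open>
  Scaling by \<open>\<Omega> p\<close> turns orthonormal bases of the conformal metric into orthonormal bases of the round
  one.
\<close>

lemma metric_trace_conformal:
  assumes p: "p \<in> S2" and \<Omega>: "\<Omega> p > 0" and B: "bilinear B"
    and T: "\<And>u v. u \<in> tangent_space p \<Longrightarrow> v \<in> tangent_space p \<Longrightarrow> T p u v = B u v"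
  shows "metric_trace (conformal_metric \<Omega>) T p = tangential_trace p B / (\<Omega> p)\<^sup>2"
  unfolding metric_trace_def
proof (rule the_equality)
  note bil = bilinear_lmul[OF B] bilinear_rmul[OF B]
  have tr: "tangential_trace p B / (\<Omega> p)\<^sup>2 = T p e1 e1 + T p e2 e2"
    if e: "orthonormal_basis_at (conformal_metric \<Omega>) p e1 e2" for e1 e2
  proof -
    have "orthonormal_basis_at round_metric p (\<Omega> p *\<^sub>R e1) (\<Omega> p *\<^sub>R e2)"
      using e by (simp add: orthonormal_basis_at_def conformal_metric_def round_metric_def
          tangent_space_def power2_eq_square mult.assoc)
    from tangential_trace_orthonormal[OF p this B]
    have "tangential_trace p B = (\<Omega> p)\<^sup>2 * (B e1 e1 + B e2 e2)"
      unfolding bil by (simp add: power2_eq_square algebra_simps)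
    then show ?thesis using e \<Omega> T by (simp add: orthonormal_basis_at_def)
  qed
  then show "\<forall>e1 e2. orthonormal_basis_at (conformal_metric \<Omega>) p e1 e2
      \<longrightarrow> tangential_trace p B / (\<Omega> p)\<^sup>2 = T p e1 e1 + T p e2 e2" by blast
  fix t assume t: "\<forall>e1 e2. orthonormal_basis_at (conformal_metric \<Omega>) p e1 e2 \<longrightarrow> t = T p e1 e1 + T p e2 e2"
  obtain e1 e2 where "orthonormal_basis_at round_metric p e1 e2"
    using orthonormal_basis_exists[OF p] .
  then have "orthonormal_basis_at (conformal_metric \<Omega>) p (inverse (\<Omega> p) *\<^sub>R e1) (inverse (\<Omega> p) *\<^sub>R e2)"
    using \<Omega> by (simp add: orthonormal_basis_at_def conformal_metric_def round_metric_def
        tangent_space_def power2_eq_square field_simps)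
  then show "t = tangential_trace p B / (\<Omega> p)\<^sup>2" using t tr by metis
qed

lemma metric_trace_round:
  assumes "p \<in> S2" "bilinear B"
    and "\<And>u v. u \<in> tangent_space p \<Longrightarrow> v \<in> tangent_space p \<Longrightarrow> T p u v = B u v"
  shows "metric_trace round_metric T p = tangential_trace p B"
  using metric_trace_conformal[of p "\<lambda>q. 1" B T] assms by (simp add: round_metric_conformal)

section \<open>Families of linear maps\<close>

text \<open>Both sides of each linearity equation are derivatives of the same function.\<close>

lemma linear_derivative_of_linear_family:
  assumes S: "open S" "x \<in> S"
    and lin: "\<And>y. y \<in> S \<Longrightarrow> linear (L y)"
    and der: "\<And>v. ((\<lambda>y. L y v) has_derivative (\<lambda>h. L' h v)) (at x)"
  shows "linear (L' h)"
proof (rule linearI)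
  fix v w
  have "((\<lambda>y. L y (v + w)) has_derivative (\<lambda>h. L' h v + L' h w)) (at x)"
    by (rule has_derivative_transform_within_open[OF has_derivative_add[OF der der] S])
      (simp add: linear_add[OF lin])
  from has_derivative_unique[OF der this] show "L' h (v + w) = L' h v + L' h w" by metis
next
  fix c v
  have "((\<lambda>y. L y (c *\<^sub>R v)) has_derivative (\<lambda>h. c *\<^sub>R L' h v)) (at x)"
    by (rule has_derivative_transform_within_open[OF has_derivative_scaleR_right[OF der] S])
      (simp add: linear_scale[OF lin])
  from has_derivative_unique[OF der this] show "L' h (c *\<^sub>R v) = c *\<^sub>R L' h v" by metis
qed

text \<open>
  A product rule for \<open>L y (V y)\<close> that needs the derivative of \<open>L\<close> only at fixed arguments.  It is
  the tool for differentiating tensors evaluated on the moving fields \<open>extend v\<close>.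
\<close>

lemma has_derivative_linear_family:
  fixes L :: "'a::real_normed_vector \<Rightarrow> 'b::euclidean_space \<Rightarrow> 'c::real_normed_vector"
  assumes S: "open S" "x \<in> S"
    and lin: "\<And>y. y \<in> S \<Longrightarrow> linear (L y)"
    and der: "\<And>v. ((\<lambda>y. L y v) has_derivative (\<lambda>h. L' h v)) (at x)"
    and V: "(V has_derivative V') (at x)"
  shows "((\<lambda>y. L y (V y)) has_derivative (\<lambda>h. L' h (V x) + L x (V' h))) (at x)"
proof -
  have "((\<lambda>y. \<Sum>b\<in>Basis. (V y \<bullet> b) *\<^sub>R L y b) has_derivative
      (\<lambda>h. \<Sum>b\<in>Basis. (V x \<bullet> b) *\<^sub>R L' h b + (V' h \<bullet> b) *\<^sub>R L x b)) (at x)"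
    by (intro has_derivative_sum has_derivative_scaleR has_derivative_inner_left V der)
  then have "((\<lambda>y. L y (V y)) has_derivative
      (\<lambda>h. \<Sum>b\<in>Basis. (V x \<bullet> b) *\<^sub>R L' h b + (V' h \<bullet> b) *\<^sub>R L x b)) (at x)"
    by (rule has_derivative_transform_within_open[OF _ S]) (rule linear_eq_sum_Basis[OF lin, symmetric])
  moreover have "(\<Sum>b\<in>Basis. (V x \<bullet> b) *\<^sub>R L' h b + (V' h \<bullet> b) *\<^sub>R L x b) = L' h (V x) + L x (V' h)" for h
    unfolding sum.distrib
    by (intro arg_cong2[of _ _ _ _ "(+)"] linear_eq_sum_Basis[symmetric] lin S
        linear_derivative_of_linear_family[OF S lin der])
  ultimately show ?thesis by simp
qed

section \<open>Higher derivatives of radially constant functions\<close>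

text \<open>
  The second and third derivatives of the radially constant extension of \<open>f\<close>; the derivatives are taken
  in the order of the arguments from right to left.
\<close>

definition second_differential :: "(real^3 \<Rightarrow> real) \<Rightarrow> real^3 \<Rightarrow> real^3 \<Rightarrow> real^3 \<Rightarrow> real" where
  "second_differential f x u v = frechet_derivative (\<lambda>y. differential f y v) (at x) u"

definition third_differential :: "(real^3 \<Rightarrow> real) \<Rightarrow> real^3 \<Rightarrow> real^3 \<Rightarrow> real^3 \<Rightarrow> real^3 \<Rightarrow> real" where
  "third_differential f x t u v = frechet_derivative (\<lambda>y. second_differential f y u v) (at x) t"

definition ambient_laplacian :: "(real^3 \<Rightarrow> real) \<Rightarrow> real^3 \<Rightarrow> real" where
  "ambient_laplacian f x = (\<Sum>b\<in>Basis. second_differential f x b b)"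

context
  fixes f :: "real^3 \<Rightarrow> real"
  assumes f: "smooth_S2 f"
begin

lemma smooth_on_differential: "smooth_on (- {0}) (\<lambda>x. differential f x v)"
  using smooth_on_frechet_derivative[OF f[unfolded smooth_S2_def]] by (simp add: differential_def)

lemma smooth_on_second_differential: "smooth_on (- {0}) (\<lambda>x. second_differential f x u v)"
  using smooth_on_frechet_derivative[OF smooth_on_differential] by (simp add: second_differential_def)

lemma has_derivative_second_differential:
  "x \<noteq> 0 \<Longrightarrow> ((\<lambda>y. differential f y v) has_derivative (\<lambda>h. second_differential f x h v)) (at x)"
  using smooth_on_has_derivative[OF smooth_on_differential] by (simp add: second_differential_def)

lemma has_derivative_third_differential:
  "x \<noteq> 0 \<Longrightarrow> ((\<lambda>y. second_differential f y u v) has_derivative (\<lambda>h. third_differential f x h u v)) (at x)"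
  using smooth_on_has_derivative[OF smooth_on_second_differential] by (simp add: third_differential_def)

lemma second_differential_symmetric:
  assumes "x \<noteq> 0"
  shows "second_differential f x u v = second_differential f x v u"
  unfolding second_differential_def differential_def
  by (rule frechet_derivative_symmetric[OF open_punctured])
    (use assms f in \<open>simp_all add: smooth_S2_def smooth_on_def\<close>)

lemma bilinear_second_differential:
  assumes x: "x \<noteq> 0"
  shows "bilinear (second_differential f x)"
  unfolding bilinear_def
proof (intro conjI allI)
  show "linear (second_differential f x u)" for u
    by (rule linear_derivative_of_linear_family[OF open_punctured, where L = "differential f"])
      (use x linear_differential[OF f] has_derivative_second_differential in auto)
  show "linear (\<lambda>u. second_differential f x u v)" for v
    using has_derivative_linear[OF has_derivative_second_differential[OF x]] .
qed

lemma third_differential_symmetric: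
  assumes "x \<noteq> 0"
  shows "third_differential f x t u v = third_differential f x u t v"
    and "third_differential f x t u v = third_differential f x t v u"
proof -
  show "third_differential f x t u v = third_differential f x u t v"
    unfolding third_differential_def second_differential_def
    by (rule frechet_derivative_symmetric[OF open_punctured])
      (use assms smooth_on_differential in \<open>simp_all add: smooth_on_def\<close>)
  have "((\<lambda>y. second_differential f y u v) has_derivative (\<lambda>h. third_differential f x h v u)) (at x)"
    by (rule has_derivative_transform_within_open[OF has_derivative_third_differential[OF assms] open_punctured])
      (use assms second_differential_symmetric in auto)
  from has_derivative_unique[OF has_derivative_third_differential[OF assms] this]
  show "third_differential f x t u v = third_differential f x t v u" by metis
qed

lemma linear_third_differential:
  assumes x: "x \<noteq> 0"
  shows "linear (\<lambda>t. third_differential f x t u v)" "linear (\<lambda>u. third_differential f x t u v)"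
    "linear (\<lambda>v. third_differential f x t u v)"
proof -
  show "linear (\<lambda>t. third_differential f x t u v)" for u v
    using has_derivative_linear[OF has_derivative_third_differential[OF x]] .
  then show "linear (\<lambda>u. third_differential f x t u v)" for t v
    by (subst third_differential_symmetric(1)[OF x])
  then show "linear (\<lambda>v. third_differential f x t u v)"
    by (subst third_differential_symmetric(2)[OF x])
qed

text \<open>Euler's relation: differentiate \<open>differential f y y = 0\<close> with respect to \<open>y\<close>.\<close>

lemma second_differential_radial:
  assumes x: "x \<noteq> 0"
  shows "second_differential f x u x = - differential f x u"
    and "second_differential f x x u = - differential f x u"
proof -
  have "((\<lambda>y. differential f y y) has_derivative (\<lambda>h. second_differential f x h x + differential f x h)) (at x)"
    by (rule has_derivative_linear_family[OF open_punctured, where L' = "second_differential f x"])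
      (use x linear_differential[OF f] has_derivative_second_differential in auto)
  moreover have "((\<lambda>y. differential f y y) has_derivative (\<lambda>h. 0)) (at x)"
    by (rule has_derivative_transform_within_open[OF has_derivative_const open_punctured])
      (use x differential_radial[OF f] in auto)
  ultimately have "(\<lambda>h. second_differential f x h x + differential f x h) = (\<lambda>h. 0)"
    by (rule has_derivative_unique)
  from fun_cong[OF this, of u] show "second_differential f x u x = - differential f x u" by simp
  then show "second_differential f x x u = - differential f x u"
    using second_differential_symmetric[OF x] by metis
qed

text \<open>
  Differentiating \<open>second_differential f y u y = - differential f y u\<close> once more produces two equal
  second derivatives on the two sides.
\<close>

lemma third_differential_radial:
  assumes x: "x \<noteq> 0"
  shows "third_differential f x t u x = - 2 * second_differential f x t u"
proof -
  have "((\<lambda>y. second_differential f y u y) has_derivative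
      (\<lambda>h. third_differential f x h u x + second_differential f x u h)) (at x)"
    by (rule has_derivative_linear_family[OF open_punctured, where L' = "\<lambda>h. third_differential f x h u"])
      (use x bilinear_second_differential has_derivative_third_differential in \<open>auto simp: bilinear_def\<close>)
  moreover have "((\<lambda>y. second_differential f y u y) has_derivative (\<lambda>h. - second_differential f x h u)) (at x)"
    by (rule has_derivative_transform_within_open[OF has_derivative_minus[OF has_derivative_second_differential[OF x]]
          open_punctured]) (use x second_differential_radial in auto)
  ultimately have "(\<lambda>h. third_differential f x h u x + second_differential f x u h) = (\<lambda>h. - second_differential f x h u)"
    by (rule has_derivative_unique)
  from fun_cong[OF this, of t] show ?thesis using second_differential_symmetric[OF x, of u t] by simp
qed

lemma has_derivative_differential_along:
  assumes "x \<noteq> 0" "(V has_derivative V') (at x)"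
  shows "((\<lambda>y. differential f y (V y)) has_derivative
    (\<lambda>h. second_differential f x h (V x) + differential f x (V' h))) (at x)"
  by (rule has_derivative_linear_family[OF open_punctured])
    (use assms linear_differential[OF f] has_derivative_second_differential in auto)

lemma has_derivative_second_differential_along:
  assumes x: "x \<noteq> 0" and V: "(V has_derivative V') (at x)" and W: "(W has_derivative W') (at x)"
  shows "((\<lambda>y. second_differential f y (V y) (W y)) has_derivative
    (\<lambda>h. third_differential f x h (V x) (W x) + second_differential f x (V' h) (W x)
       + second_differential f x (V x) (W' h))) (at x)"
proof (rule has_derivative_linear_family[OF open_punctured _ _ _ W,
      where L' = "\<lambda>h w. third_differential f x h (V x) w + second_differential f x (V' h) w"])
  show "((\<lambda>y. second_differential f y (V y) w) has_derivative
      (\<lambda>h. third_differential f x h (V x) w + second_differential f x (V' h) w)) (at x)" for w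
    by (rule has_derivative_linear_family[OF open_punctured _ _ _ V,
          where L = "\<lambda>y u. second_differential f y u w" and L' = "\<lambda>h u. third_differential f x h u w"])
      (use x bilinear_second_differential has_derivative_third_differential in \<open>auto simp: bilinear_def\<close>)
qed (use x bilinear_second_differential in \<open>auto simp: bilinear_def\<close>)

lemma has_derivative_ambient_laplacian:
  "x \<noteq> 0 \<Longrightarrow> (ambient_laplacian f has_derivative (\<lambda>h. \<Sum>b\<in>Basis. third_differential f x h b b)) (at x)"
  unfolding ambient_laplacian_def[abs_def]
  by (intro has_derivative_sum has_derivative_third_differential)

lemma has_derivative_gradient:
  "x \<noteq> 0 \<Longrightarrow> (gradient f has_derivative (\<lambda>h. \<Sum>b\<in>Basis. second_differential f x h b *\<^sub>R b)) (at x)"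
  unfolding gradient_def[abs_def]
  by (intro has_derivative_sum has_derivative_scaleR_left has_derivative_second_differential)

text \<open>The derivative of the gradient represents the second derivative.\<close>

lemma inner_hessian_vector:
  assumes "x \<noteq> 0"
  shows "(\<Sum>b\<in>Basis. second_differential f x h b *\<^sub>R b) \<bullet> k = second_differential f x h k"
  using linear_eq_sum_Basis[of "second_differential f x h" k] bilinear_second_differential[OF assms]
  by (simp add: inner_sum_left mult.commute inner_commute[of k] bilinear_def)

end

section \<open>Curvature of the conformal metric\<close>

lemma differential_extend:
  assumes "p \<in> S2" "u \<in> tangent_space p"
  shows "differential (extend v) p u = - ((v \<bullet> u) *\<^sub>R p + (v \<bullet> p) *\<^sub>R u)"
  using differential_tangent[OF assms(1) has_derivative_extend refl assms(2)] .

text \<open>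
  This holds at every point of the sphere, not only where \<open>u\<close> and \<open>v\<close> are tangent, since the curvature
  differentiates the covariant derivative once more.
\<close>

lemma conformal_connection_extend:
  assumes q: "q \<in> S2"
  shows "conformal_connection \<phi> (extend u) (extend v) q
    = - ((v \<bullet> q) *\<^sub>R extend u q) + differential \<phi> q (extend u q) *\<^sub>R extend v q
      + differential \<phi> q (extend v q) *\<^sub>R extend u q - (extend u q \<bullet> extend v q) *\<^sub>R gradient \<phi> q"
proof -
  have "extend u q \<bullet> extend v q = v \<bullet> extend u q"
    using vector_fieldsD(3)[OF extend_vector_field q, of u]
    by (subst (2) extend_def) (simp add: inner_diff_right inner_commute)
  then show ?thesis
    by (simp add: conformal_connection_def differential_extend[OF q vector_fieldsD(2)[OF extend_vector_field q]])
qed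

context
  fixes \<phi> :: "real^3 \<Rightarrow> real" and p :: "real^3"
  assumes \<phi>: "smooth_S2 \<phi>" and p: "p \<in> S2"
begin

text \<open>
  At \<open>p\<close> most terms of the product rule vanish: \<open>extend u\<close> and \<open>extend v\<close> have normal derivatives
  there, and \<open>\<phi>\<close> has no radial derivative.
\<close>

lemma differential_conformal_connection_extend:
  assumes u: "u \<in> tangent_space p" and v: "v \<in> tangent_space p" and w: "w \<in> tangent_space p"
    and Y: "\<And>q. q \<in> S2 \<Longrightarrow> Y q = conformal_connection \<phi> (extend u) (extend v) q"
  shows "differential Y p w =
    - ((v \<bullet> w) *\<^sub>R u)
    + second_differential \<phi> p w u *\<^sub>R v - (differential \<phi> p u * (v \<bullet> w)) *\<^sub>R p
    + second_differential \<phi> p w v *\<^sub>R u - (differential \<phi> p v * (u \<bullet> w)) *\<^sub>R p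
    - (u \<bullet> v) *\<^sub>R (\<Sum>b\<in>Basis. second_differential \<phi> p w b *\<^sub>R b)"
proof -
  note p0 = S2_simps(2)[OF p]
  note t = tangent_spaceD[OF u] tangent_spaceD[OF v] tangent_spaceD[OF w]
  note lin = linear_differential[OF \<phi> p0]
  note [derivative_intros] = has_derivative_extend has_derivative_gradient[OF \<phi> p0]
    has_derivative_differential_along[OF \<phi> p0]
  have "differential Y p w =
     - ((v \<bullet> p) *\<^sub>R (- ((u \<bullet> w) *\<^sub>R p + (u \<bullet> p) *\<^sub>R w)) + (v \<bullet> w) *\<^sub>R extend u p)
     + (differential \<phi> p (extend u p) *\<^sub>R (- ((v \<bullet> w) *\<^sub>R p + (v \<bullet> p) *\<^sub>R w))
       + (second_differential \<phi> p w (extend u p) + differential \<phi> p (- ((u \<bullet> w) *\<^sub>R p + (u \<bullet> p) *\<^sub>R w))) *\<^sub>R extend v p)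
     + (differential \<phi> p (extend v p) *\<^sub>R (- ((u \<bullet> w) *\<^sub>R p + (u \<bullet> p) *\<^sub>R w))
       + (second_differential \<phi> p w (extend v p) + differential \<phi> p (- ((v \<bullet> w) *\<^sub>R p + (v \<bullet> p) *\<^sub>R w))) *\<^sub>R extend u p)
     - ((extend u p \<bullet> extend v p) *\<^sub>R (\<Sum>b\<in>Basis. second_differential \<phi> p w b *\<^sub>R b)
       + (extend u p \<bullet> (- ((v \<bullet> w) *\<^sub>R p + (v \<bullet> p) *\<^sub>R w)) + (- ((u \<bullet> w) *\<^sub>R p + (u \<bullet> p) *\<^sub>R w)) \<bullet> extend v p) *\<^sub>R gradient \<phi> p)"
    by (rule differential_tangent[OF p _ _ w]) (auto intro!: derivative_eq_intros simp: Y conformal_connection_extend)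
  then show ?thesis
    by (simp add: t extend_tangent[OF u] extend_tangent[OF v] linear_neg[OF lin] linear_scale[OF lin]
        differential_radial[OF \<phi> p0])
qed

text \<open>The second covariant derivative, from which the curvature arises by antisymmetrisation.\<close>

lemma conformal_connection_twice:
  assumes u: "u \<in> tangent_space p" and v: "v \<in> tangent_space p" and w: "w \<in> tangent_space p"
    and k: "k \<in> tangent_space p"
    and Y: "\<And>q. q \<in> S2 \<Longrightarrow> Y q = conformal_connection \<phi> (extend u) (extend v) q"
  defines "F \<equiv> differential \<phi> p" and "H \<equiv> second_differential \<phi> p"
  shows "conformal_connection \<phi> (extend w) Y p \<bullet> k =
    - (v \<bullet> w) * (u \<bullet> k) + H w u * (v \<bullet> k) + H w v * (u \<bullet> k) - (u \<bullet> v) * H w k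
    + F w * (F u * (v \<bullet> k) + F v * (u \<bullet> k) - (u \<bullet> v) * F k)
    + (2 * F u * F v - (u \<bullet> v) * F (gradient \<phi> p)) * (w \<bullet> k)
    - (F u * (v \<bullet> w) + F v * (u \<bullet> w) - (u \<bullet> v) * F w) * F k"
proof -
  note p0 = S2_simps(2)[OF p]
  note t = tangent_spaceD[OF u] tangent_spaceD[OF v] tangent_spaceD[OF w] tangent_spaceD[OF k]
  note lin = linear_differential[OF \<phi> p0]
  have Yp: "Y p = F u *\<^sub>R v + F v *\<^sub>R u - (u \<bullet> v) *\<^sub>R gradient \<phi> p"
    using Y[OF p] by (simp add: conformal_connection_extend[OF p] extend_tangent u v t F_def)
  have FY: "F (Y p) = 2 * F u * F v - (u \<bullet> v) * F (gradient \<phi> p)"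
    unfolding Yp F_def by (simp add: linear_add[OF lin] linear_diff[OF lin] linear_scale[OF lin])
  have Yk: "Y p \<bullet> z = F u * (v \<bullet> z) + F v * (u \<bullet> z) - (u \<bullet> v) * F z" for z
    unfolding Yp F_def by (simp add: inner_add_left inner_diff_left inner_gradient[OF \<phi> p0])
  have d: "differential Y p w \<bullet> k = - (v \<bullet> w) * (u \<bullet> k) + H w u * (v \<bullet> k) + H w v * (u \<bullet> k) - (u \<bullet> v) * H w k"
    using differential_conformal_connection_extend[OF u v w Y]
    by (simp add: inner_add_left inner_diff_left t inner_hessian_vector[OF \<phi> p0] H_def)
  have "conformal_connection \<phi> (extend w) Y p \<bullet> k
      = differential Y p w \<bullet> k + F w * (Y p \<bullet> k) + F (Y p) * (w \<bullet> k) - (Y p \<bullet> w) * F k"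
    by (simp add: conformal_connection_def extend_tangent[OF w] inner_add_left inner_diff_left t
        inner_gradient[OF \<phi> p0] F_def inner_commute[of w])
  then show ?thesis unfolding d FY Yk by simp
qed

lemma bilinear_differential_square: "bilinear (\<lambda>u v. differential \<phi> p u * differential \<phi> p v)"
proof -
  note lin = linear_differential[OF \<phi> S2_simps(2)[OF p]]
  show ?thesis unfolding bilinear_def
    by (auto intro!: linearI simp: linear_add[OF lin] linear_scale[OF lin] algebra_simps)
qed

lemma tangential_trace_second_differential:
  "tangential_trace p (second_differential \<phi> p) = ambient_laplacian \<phi> p"
  using S2_simps[OF p] by (simp add: tangential_trace_def ambient_laplacian_def
      second_differential_radial[OF \<phi>] differential_radial[OF \<phi>])

lemma differential_gradient: "differential \<phi> p (gradient \<phi> p) = gradient \<phi> p \<bullet> gradient \<phi> p"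
  using inner_gradient(1)[OF \<phi> S2_simps(2)[OF p]] by simp

lemma tangential_trace_differential_square:
  "tangential_trace p (\<lambda>u v. differential \<phi> p u * differential \<phi> p v) = gradient \<phi> p \<bullet> gradient \<phi> p"
proof -
  note p0 = S2_simps(2)[OF p]
  show ?thesis
    using euclidean_inner[of "gradient \<phi> p" "gradient \<phi> p"]
    by (simp add: tangential_trace_def differential_radial[OF \<phi> p0] inner_gradient[OF \<phi> p0])
qed

text \<open>
  The terms quadratic in \<open>d\<phi>\<close> appear once as \<open>- |d\<phi>|\<^sup>2\<close> times the Gram determinant and once as
  \<open>d\<phi> \<otimes> d\<phi>\<close> in the pattern of \<open>tangential_trace_gram\<close>, with opposite effect.  One factor \<open>\<Omega>\<^sup>2\<close> comes
  from the pairing with \<open>u\<close> and two from the Gram determinant of the conformal metric, whence the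
  division by \<open>\<Omega>\<^sup>2\<close>.
\<close>

lemma gauss_curvature_conformal:
  assumes \<Omega>: "\<And>q. q \<in> S2 \<Longrightarrow> \<Omega> q = exp (\<phi> q)"
  shows "gauss_curvature (conformal_metric \<Omega>) p = (1 - ambient_laplacian \<phi> p) / (\<Omega> p)\<^sup>2"
proof -
  let ?h = "conformal_metric \<Omega>" and ?D = "levi_civita (conformal_metric \<Omega>)"
  let ?F = "differential \<phi> p" and ?H = "second_differential \<phi> p" and ?N = "gradient \<phi> p \<bullet> gradient \<phi> p"
  note p0 = S2_simps(2)[OF p]
  have D: "?D X Y \<in> vector_fields" "q \<in> S2 \<Longrightarrow> ?D X Y q = conformal_connection \<phi> X Y q"
    if "X \<in> vector_fields" "Y \<in> vector_fields" for X Y q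
    using levi_civita_conformal(1)[of \<phi> \<Omega> X Y] levi_civita_conformal(2)[of \<phi> \<Omega> X Y q] \<phi> \<Omega> that by auto
  have pos: "\<Omega> p > 0" using \<Omega>[OF p] by simp
  have R: "?h p (curvature ?h (extend u) (extend v) (extend v) p) u
      = (1 - ambient_laplacian \<phi> p) / (\<Omega> p)\<^sup>2 * (?h p u u * ?h p v v - (?h p u v)\<^sup>2)"
    if u: "u \<in> tangent_space p" and v: "v \<in> tangent_space p" for u v
  proof -
    note e = extend_vector_field
    \<comment> \<open>Both ambient derivatives equal \<open>- \<langle>u, v\<rangle> p\<close>, so the bracket term of the curvature drops out.\<close>
    have "lie_bracket (extend u) (extend v) p = 0"
      by (simp add: lie_bracket_def extend_tangent u v differential_extend[OF p] tangent_spaceD[OF u]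
          tangent_spaceD[OF v] inner_commute)
    then have "?D (lie_bracket (extend u) (extend v)) (extend v) p = 0"
      using linear_0[OF linear_differential[OF \<phi> p0]]
        linear_0[OF linear_differential[OF vector_fieldsD(1)[OF e] p0]]
      by (simp add: D(2)[OF lie_bracket_vector_field[OF e e] e p] conformal_connection_def)
    then have C: "curvature ?h (extend u) (extend v) (extend v) p \<bullet> u
        = conformal_connection \<phi> (extend u) (?D (extend v) (extend v)) p \<bullet> u
        - conformal_connection \<phi> (extend v) (?D (extend u) (extend v)) p \<bullet> u"
      by (simp add: curvature_def Let_def D(2)[OF e D(1)[OF e e] p] inner_diff_left)
    have "curvature ?h (extend u) (extend v) (extend v) p \<bullet> u
        = (u \<bullet> u) * (v \<bullet> v) - (u \<bullet> v)\<^sup>2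
          - (?N * ((u \<bullet> u) * (v \<bullet> v) - (u \<bullet> v)\<^sup>2))
          - ((u \<bullet> u) * ?H v v + (v \<bullet> v) * ?H u u - (u \<bullet> v) * (?H u v + ?H v u))
          + ((u \<bullet> u) * (?F v * ?F v) + (v \<bullet> v) * (?F u * ?F u) - (u \<bullet> v) * (?F u * ?F v + ?F v * ?F u))"
      by (simp add: C conformal_connection_twice[OF v v u u D(2)[OF e e]]
          conformal_connection_twice[OF u v v u D(2)[OF e e]] second_differential_symmetric[OF \<phi> p0, of u v]
          differential_gradient inner_commute[of v u] power2_eq_square algebra_simps)
    also have "\<dots> = ((u \<bullet> u) * (v \<bullet> v) - (u \<bullet> v)\<^sup>2) * (1 - ambient_laplacian \<phi> p)"
      unfolding tangential_trace_gram[OF p bilinear_second_differential[OF \<phi> p0] u v]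
        tangential_trace_gram[OF p bilinear_differential_square u v]
        tangential_trace_second_differential tangential_trace_differential_square
      by (simp add: algebra_simps)
    finally have R: "curvature ?h (extend u) (extend v) (extend v) p \<bullet> u
        = ((u \<bullet> u) * (v \<bullet> v) - (u \<bullet> v)\<^sup>2) * (1 - ambient_laplacian \<phi> p)" .
    show ?thesis
      using pos by (simp add: conformal_metric_def round_metric_def R power2_eq_square field_simps)
  qed
  show ?thesis
    unfolding gauss_curvature_def
  proof (rule the_equality)
    fix k
    assume k: "\<forall>u\<in>tangent_space p. \<forall>v\<in>tangent_space p.
        ?h p (curvature ?h (extend u) (extend v) (extend v) p) u = k * (?h p u u * ?h p v v - (?h p u v)\<^sup>2)"
    obtain e1 e2 where e: "orthonormal_basis_at round_metric p e1 e2"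
      using orthonormal_basis_exists[OF p] .
    then have t: "e1 \<in> tangent_space p" "e2 \<in> tangent_space p" by (auto simp: orthonormal_basis_at_def)
    have "?h p e1 e1 * ?h p e2 e2 - (?h p e1 e2)\<^sup>2 \<noteq> 0"
      using e pos by (simp add: orthonormal_basis_at_def conformal_metric_def)
    with k[rule_format, OF t] R[OF t] show "k = (1 - ambient_laplacian \<phi> p) / (\<Omega> p)\<^sup>2"
      by (metis mult_right_cancel)
  qed (use R in blast)
qed

section \<open>The tensor of the conformal factor and its divergence\<close>

lemma hessian_round:
  assumes u: "u \<in> tangent_space p" and v: "v \<in> tangent_space p"
  shows "hessian round_metric \<phi> p u v = second_differential \<phi> p u v"
proof -
  note p0 = S2_simps(2)[OF p]
  note lin = linear_differential[OF \<phi> p0]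
  have "differential (\<lambda>q. differential \<phi> q (extend v q)) p u
      = second_differential \<phi> p u (extend v p) + differential \<phi> p (- ((v \<bullet> u) *\<^sub>R p + (v \<bullet> p) *\<^sub>R u))"
    by (rule differential_tangent[OF p has_derivative_differential_along[OF \<phi> p0 has_derivative_extend] refl u])
  then show ?thesis
    by (simp add: hessian_def levi_civita_round_extend[OF p u v] extend_tangent[OF v] linear_neg[OF lin]
        linear_scale[OF lin] linear_0[OF lin] differential_radial[OF \<phi> p0] tangent_spaceD[OF v])
qed

lemma laplacian_round: "laplacian round_metric \<phi> p = ambient_laplacian \<phi> p"
  unfolding laplacian_def
  using metric_trace_round[OF p bilinear_second_differential[OF \<phi> S2_simps(2)[OF p]], of "hessian round_metric \<phi>"]
  by (simp add: hessian_round tangential_trace_second_differential)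

lemma covector_norm2_round:
  "covector_norm2 round_metric (differential \<phi>) p = gradient \<phi> p \<bullet> gradient \<phi> p"
  unfolding covector_norm2_def
  using metric_trace_round[OF p bilinear_differential_square] by (simp add: tangential_trace_differential_square)

context
  fixes \<Omega> :: "real^3 \<Rightarrow> real"
  assumes \<Omega>: "\<phi> = (\<lambda>q. ln (\<Omega> q))"
begin

lemma Xi_tangent:
  assumes u: "u \<in> tangent_space p" and v: "v \<in> tangent_space p"
  shows "Xi \<Omega> p u v = (gradient \<phi> p \<bullet> gradient \<phi> p - 1) * (u \<bullet> v)
     - 2 * (differential \<phi> p u * differential \<phi> p v) + 2 * second_differential \<phi> p u v"
  unfolding Xi_def Let_def \<Omega>[symmetric] hessian_round[OF u v] covector_norm2_round round_metric_def
  by (simp add: algebra_simps)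

lemma metric_trace_Xi:
  assumes "\<omega> p > 0"
  shows "metric_trace (conformal_metric \<omega>) (Xi \<Omega>) p = - 2 * (1 - ambient_laplacian \<phi> p) / (\<omega> p)\<^sup>2"
proof -
  let ?N = "gradient \<phi> p \<bullet> gradient \<phi> p"
  let ?B = "\<lambda>u v. (?N - 1) * (u \<bullet> v) - 2 * (differential \<phi> p u * differential \<phi> p v)
      + 2 * second_differential \<phi> p u v"
  note H = bilinear_second_differential[OF \<phi> S2_simps(2)[OF p]]
  note lin = linear_differential[OF \<phi> S2_simps(2)[OF p]]
  have "bilinear ?B"
    unfolding bilinear_def
    by (intro conjI allI linearI)
      (simp_all add: linear_add[OF lin] linear_scale[OF lin] bilinear_ladd[OF H] bilinear_radd[OF H]
        bilinear_lmul[OF H] bilinear_rmul[OF H] inner_add_left inner_add_right algebra_simps)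
  then have "metric_trace (conformal_metric \<omega>) (Xi \<Omega>) p = tangential_trace p ?B / (\<omega> p)\<^sup>2"
    using metric_trace_conformal[of p \<omega> ?B "Xi \<Omega>", OF p] assms Xi_tangent by simp
  moreover have "tangential_trace p ?B = (?N - 1) * 2
      - 2 * tangential_trace p (\<lambda>u v. differential \<phi> p u * differential \<phi> p v)
      + 2 * tangential_trace p (second_differential \<phi> p)"
    using S2_simps[OF p]
    by (simp add: tangential_trace_def sum.distrib sum_subtractf sum_distrib_left[symmetric] algebra_simps)
  ultimately show ?thesis
    by (simp add: tangential_trace_differential_square tangential_trace_second_differential)
qed

lemma trace_free_part_Xi:
  assumes "u \<in> tangent_space p" "v \<in> tangent_space p"
  shows "trace_free_part round_metric (Xi \<Omega>) p u v
     = (gradient \<phi> p \<bullet> gradient \<phi> p - ambient_laplacian \<phi> p) * (u \<bullet> v)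
       - 2 * (differential \<phi> p u * differential \<phi> p v) + 2 * second_differential \<phi> p u v"
  using metric_trace_Xi[of "\<lambda>q. 1"]
  by (simp add: trace_free_part_def Xi_tangent[OF assms] round_metric_conformal[symmetric])
    (simp add: round_metric_def field_simps)

end

end

text \<open>
  The derivatives of \<open>extend v\<close> and \<open>extend w\<close> at \<open>p\<close> are multiples of \<open>p\<close>.  They contribute through
  the Hessian term only, where Euler's relation \<open>D\<^sup>2F (p, w) = - DF w\<close> turns them into the last
  two summands.
\<close>

lemma covariant_derivative_trace_free_Xi:
  assumes \<phi>: "smooth_S2 (\<lambda>q. ln (\<Omega> q))" and p: "p \<in> S2"
    and u: "u \<in> tangent_space p" and v: "v \<in> tangent_space p" and w: "w \<in> tangent_space p"
  defines "\<phi> \<equiv> \<lambda>q. ln (\<Omega> q)"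
  shows "covariant_derivative round_metric (trace_free_part round_metric (Xi \<Omega>)) p u v w
    = (2 * second_differential \<phi> p u (gradient \<phi> p) - (\<Sum>b\<in>Basis. third_differential \<phi> p u b b)) * (v \<bullet> w)
      - 2 * second_differential \<phi> p u v * differential \<phi> p w
      - 2 * differential \<phi> p v * second_differential \<phi> p u w
      + 2 * third_differential \<phi> p u v w
      + 2 * (v \<bullet> u) * differential \<phi> p w + 2 * (w \<bullet> u) * differential \<phi> p v"
proof -
  have \<phi>: "smooth_S2 \<phi>" using \<phi> by (simp add: \<phi>_def)
  note p0 = S2_simps(2)[OF p]
  note lin = linear_differential[OF \<phi> p0]
  note t = tangent_spaceD[OF u] tangent_spaceD[OF v] tangent_spaceD[OF w]
  let ?F = "differential \<phi> p" and ?H = "second_differential \<phi> p" and ?G = "gradient \<phi> p"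
  note bil = bilinear_lneg[OF bilinear_second_differential[OF \<phi> p0]]
    bilinear_rneg[OF bilinear_second_differential[OF \<phi> p0]]
    bilinear_lmul[OF bilinear_second_differential[OF \<phi> p0]]
    bilinear_rmul[OF bilinear_second_differential[OF \<phi> p0]]
  let ?T = "trace_free_part round_metric (Xi \<Omega>)"
  note T = trace_free_part_Xi[OF \<phi> _ \<phi>_def[THEN meta_eq_to_obj_eq]]
  have zero: "0 \<in> tangent_space p" by (simp add: tangent_space_def)
  have T0: "?T p 0 w = 0" "?T p v 0 = 0"
    using bilinear_lzero[OF bilinear_second_differential[OF \<phi> p0]] bilinear_rzero[OF bilinear_second_differential[OF \<phi> p0]]
    by (simp_all add: T[OF p zero w] T[OF p v zero] linear_0[OF lin])
  note [derivative_intros] = has_derivative_extend has_derivative_gradient[OF \<phi> p0]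
    has_derivative_differential_along[OF \<phi> p0] has_derivative_second_differential_along[OF \<phi> p0]
    has_derivative_ambient_laplacian[OF \<phi> p0]
  let ?dV = "- ((v \<bullet> u) *\<^sub>R p + (v \<bullet> p) *\<^sub>R u)" and ?dW = "- ((w \<bullet> u) *\<^sub>R p + (w \<bullet> p) *\<^sub>R u)"
  have "differential (\<lambda>q. ?T q (extend v q) (extend w q)) p u =
      (?G \<bullet> ?G - ambient_laplacian \<phi> p) * (extend v p \<bullet> ?dW + ?dV \<bullet> extend w p)
      + (2 * ((\<Sum>b\<in>Basis. ?H u b *\<^sub>R b) \<bullet> ?G) - (\<Sum>b\<in>Basis. third_differential \<phi> p u b b)) * (extend v p \<bullet> extend w p)
      - 2 * (?F (extend v p) * (?H u (extend w p) + ?F ?dW) + (?H u (extend v p) + ?F ?dV) * ?F (extend w p))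
      + 2 * (third_differential \<phi> p u (extend v p) (extend w p) + ?H ?dV (extend w p) + ?H (extend v p) ?dW)"
  proof (rule differential_tangent[OF p _ _ u])
    show "?T q (extend v q) (extend w q) = (gradient \<phi> q \<bullet> gradient \<phi> q - ambient_laplacian \<phi> q) * (extend v q \<bullet> extend w q)
       - 2 * (differential \<phi> q (extend v q) * differential \<phi> q (extend w q))
       + 2 * second_differential \<phi> q (extend v q) (extend w q)" if "q \<in> S2" for q
      using T[OF that] vector_fieldsD(2)[OF extend_vector_field that] by blast
  qed (auto intro!: derivative_eq_intros simp: inner_commute algebra_simps)
  then show ?thesis
    by (simp add: covariant_derivative_def levi_civita_round_extend[OF p] u v w T0 extend_tangent[OF v] extend_tangent[OF w]
        t inner_hessian_vector[OF \<phi> p0] linear_neg[OF lin] linear_scale[OF lin] bil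
        differential_radial[OF \<phi> p0] second_differential_radial[OF \<phi> p0] algebra_simps)
qed

text \<open>
  The Bochner identity in ambient form.  The full trace of \<open>2 D\<^sup>3F\<close> is \<open>2 dL\<close>.  The summands left by
  the moving fields have full trace \<open>6 d\<phi> + 2 d\<phi>\<close>, and the normal entry to be subtracted is \<open>6 d\<phi>\<close>;
  the difference \<open>2 d\<phi>\<close> is twice the Ricci term of the unit sphere.
\<close>

lemma divergence_trace_free_Xi:
  assumes \<phi>: "smooth_S2 (\<lambda>q. ln (\<Omega> q))" and p: "p \<in> S2" and w: "w \<in> tangent_space p"
  defines "\<phi> \<equiv> \<lambda>q. ln (\<Omega> q)"
  shows "divergence round_metric (trace_free_part round_metric (Xi \<Omega>)) p w
    = (\<Sum>b\<in>Basis. third_differential \<phi> p w b b) + 2 * (1 - ambient_laplacian \<phi> p) * differential \<phi> p w"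
proof -
  have \<phi>': "smooth_S2 \<phi>" using \<phi> by (simp add: \<phi>_def)
  note p0 = S2_simps(2)[OF p]
  let ?F = "differential \<phi> p" and ?H = "second_differential \<phi> p" and ?G = "gradient \<phi> p"
    and ?D = "third_differential \<phi> p"
  let ?L = "\<lambda>u. \<Sum>b\<in>Basis. ?D u b b"
  define g where "g u = 2 * ?H u ?G - ?L u" for u
  let ?B = "\<lambda>u v. g u * (v \<bullet> w) - 2 * ?H u v * ?F w - 2 * ?F v * ?H u w + 2 * ?D u v w
      + 2 * (v \<bullet> u) * ?F w + 2 * (w \<bullet> u) * ?F v"
  note lin = linear_differential[OF \<phi>' p0]
  note H = bilinear_second_differential[OF \<phi>' p0]
  note D = linear_third_differential[OF \<phi>' p0]
  note sym = third_differential_symmetric[OF \<phi>' p0]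
  have g: "linear g"
    using linear_compose_sub[OF _ has_derivative_linear[OF has_derivative_ambient_laplacian[OF \<phi>' p0]],
        of "\<lambda>u. 2 * ?H u ?G"] linear_compose_scale_right[of "\<lambda>u. ?H u ?G" 2] H
    unfolding g_def[abs_def] bilinear_def by simp
  have B: "bilinear ?B"
    unfolding bilinear_def
    by (intro conjI allI linearI)
      (simp_all add: linear_add[OF g] linear_scale[OF g] linear_add[OF lin] linear_scale[OF lin]
        bilinear_ladd[OF H] bilinear_radd[OF H] bilinear_lmul[OF H] bilinear_rmul[OF H]
        linear_add[OF D(1)] linear_add[OF D(2)] linear_scale[OF D(1)] linear_scale[OF D(2)]
        inner_add_left inner_add_right algebra_simps)
  have "divergence round_metric (trace_free_part round_metric (Xi \<Omega>)) p w = tangential_trace p ?B"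
    unfolding divergence_def
    by (rule metric_trace_round[OF p B])
      (simp add: covariant_derivative_trace_free_Xi[OF \<phi> p _ _ w] g_def \<phi>_def)
  also have "tangential_trace p ?B = (\<Sum>b\<in>Basis. (w \<bullet> b) *\<^sub>R g b) - 2 * ambient_laplacian \<phi> p * ?F w
      - 2 * (\<Sum>b\<in>Basis. (?G \<bullet> b) *\<^sub>R ?H b w) + 2 * (\<Sum>b\<in>Basis. ?D b b w) + 6 * ?F w
      + 2 * (\<Sum>b\<in>Basis. (w \<bullet> b) *\<^sub>R ?F b) - ?B p p"
    by (simp add: tangential_trace_def ambient_laplacian_def sum.distrib sum_subtractf inner_gradient[OF \<phi>' p0]
        sum_distrib_left sum_distrib_right inner_commute mult_ac)
  also have "(\<Sum>b\<in>Basis. (w \<bullet> b) *\<^sub>R g b) = 2 * ?H w ?G - ?L w"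
    using linear_eq_sum_Basis[OF g, of w] by (simp add: g_def)
  also have "(\<Sum>b\<in>Basis. (?G \<bullet> b) *\<^sub>R ?H b w) = ?H w ?G"
    using linear_eq_sum_Basis[of "\<lambda>u. ?H u w" ?G] H second_differential_symmetric[OF \<phi>' p0]
    unfolding bilinear_def by metis
  also have "(\<Sum>b\<in>Basis. ?D b b w) = ?L w"
    by (rule sum.cong[OF refl]) (metis sym)
  also have "(\<Sum>b\<in>Basis. (w \<bullet> b) *\<^sub>R ?F b) = ?F w"
    by (rule linear_eq_sum_Basis[OF lin, symmetric])
  also have "?B p p = 6 * ?F w"
  proof -
    \<comment> \<open>Symmetry moves \<open>p\<close> into the last slot, the one covered by \<open>third_differential_radial\<close>.\<close>
    have "?D p p w = ?D w p p" by (metis sym)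
    then show ?thesis
      using third_differential_radial[OF \<phi>' p0, of w p] second_differential_radial[OF \<phi>' p0]
      by (simp add: tangent_spaceD[OF w] S2_simps[OF p] differential_radial[OF \<phi>' p0])
  qed
  finally show ?thesis by (simp add: algebra_simps)
qed

theorem lemma2p3:
  fixes \<Omega> :: "real^3 \<Rightarrow> real"
  assumes "smooth_S2 \<Omega>" and "\<forall>p\<in>S2. \<Omega> p > 0"
  shows "(\<forall>p\<in>S2. gauss_curvature (conformal_metric \<Omega>) p
              = (1 - laplacian round_metric (\<lambda>q. ln (\<Omega> q)) p) / (\<Omega> p)\<^sup>2)
    \<and> (\<forall>p\<in>S2. gauss_curvature (conformal_metric \<Omega>) p
              = - 1 / (2 * (\<Omega> p)\<^sup>2) * metric_trace round_metric (Xi \<Omega>) p)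
    \<and> (\<forall>p\<in>S2. gauss_curvature (conformal_metric \<Omega>) p
              = - (1/2) * metric_trace (conformal_metric \<Omega>) (Xi \<Omega>) p)
    \<and> (\<forall>p\<in>S2. \<forall>w\<in>tangent_space p.
          divergence round_metric (trace_free_part round_metric (Xi \<Omega>)) p w
          + (\<Omega> p)\<^sup>2 * differential (gauss_curvature (conformal_metric \<Omega>)) p w = 0)"
proof -
  define \<phi> where "\<phi> = (\<lambda>q. ln (\<Omega> q))"
  have \<phi>: "smooth_S2 \<phi>" unfolding \<phi>_def by (rule smooth_S2_ln[OF assms])
  have \<Omega>: "\<Omega> q = exp (\<phi> q)" if "q \<in> S2" for q using assms(2) that by (simp add: \<phi>_def)
  note K = gauss_curvature_conformal[OF \<phi> _ \<Omega>]
  have tr: "metric_trace round_metric (Xi \<Omega>) p = - 2 * (1 - ambient_laplacian \<phi> p)" if "p \<in> S2" for p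
    using metric_trace_Xi[OF \<phi> that \<phi>_def, of "\<lambda>q. 1"] by (simp add: round_metric_conformal[symmetric])
  show ?thesis
  proof (intro conjI ballI)
    fix p w assume p: "p \<in> S2" and w: "w \<in> tangent_space p"
    note p0 = S2_simps(2)[OF p]
    note [derivative_intros] = has_derivative_differential[OF \<phi> p0] has_derivative_ambient_laplacian[OF \<phi> p0]
    \<comment> \<open>\<open>K\<close> is differentiated through its extension \<open>(1 - L) exp (- 2 F)\<close>.\<close>
    have "differential (gauss_curvature (conformal_metric \<Omega>)) p w
        = (- (\<Sum>b\<in>Basis. third_differential \<phi> p w b b) - 2 * (1 - ambient_laplacian \<phi> p) * differential \<phi> p w)
          * exp (- 2 * \<phi> (sgn p))"
    proof (rule differential_tangent[OF p _ _ w])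
      show "gauss_curvature (conformal_metric \<Omega>) q = (1 - ambient_laplacian \<phi> q) * exp (- 2 * \<phi> (sgn q))"
        if "q \<in> S2" for q
        using K[OF that] \<Omega>[OF that] S2_simps[OF that]
        by (simp add: exp_minus exp_double divide_inverse)
    qed (auto intro!: derivative_eq_intros simp: algebra_simps)
    moreover have "(\<Omega> p)\<^sup>2 * exp (- 2 * \<phi> (sgn p)) = 1"
      using S2_simps[OF p] \<Omega>[OF p] by (simp add: exp_minus exp_double)
    ultimately show "divergence round_metric (trace_free_part round_metric (Xi \<Omega>)) p w
          + (\<Omega> p)\<^sup>2 * differential (gauss_curvature (conformal_metric \<Omega>)) p w = 0"
      using divergence_trace_free_Xi[OF \<phi>[unfolded \<phi>_def] p w, folded \<phi>_def]
      by (simp add: mult.left_commute[of "(\<Omega> p)\<^sup>2"])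
  next
    fix p assume p: "p \<in> S2"
    show "gauss_curvature (conformal_metric \<Omega>) p = (1 - laplacian round_metric (\<lambda>q. ln (\<Omega> q)) p) / (\<Omega> p)\<^sup>2"
      using K[OF p] laplacian_round[OF \<phi> p] by (simp add: \<phi>_def)
    show "gauss_curvature (conformal_metric \<Omega>) p = - 1 / (2 * (\<Omega> p)\<^sup>2) * metric_trace round_metric (Xi \<Omega>) p"
      using \<Omega>[OF p] by (simp add: K[OF p] tr[OF p] field_simps)
    show "gauss_curvature (conformal_metric \<Omega>) p = - (1/2) * metric_trace (conformal_metric \<Omega>) (Xi \<Omega>) p"
      using \<Omega>[OF p] by (simp add: K[OF p] metric_trace_Xi[OF \<phi> p \<phi>_def] field_simps)
  qed
qed

end
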